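(* Let $h\in\mathbb{F}[x]$ with $\deg h\ge1$, and suppose $h$ has exactly $k\ge1$ distinct roots in an algebraic closure $\overline{\mathbb{F}}$. Case $k=1$: let $\lambda$ be the unique root of $h$ in $\overline{\mathbb{F}}$. (a) If $\lambda\in\mathbb{F}$, then $\mathbb{P}=\{(\alpha,(1-\alpha)\lambda):\alpha\in\mathbb{F}^*\}$, $\tau_{\mathbb{P}}\cong\mathbb{F}^*$ via $\tau_{\alpha,(1-\alpha)\lambda}\mapsto\alpha$, and $\mathrm{Aut}_{\mathbb{F}}(A_h)=\{\phi_f\}\rtimes\tau_{\mathbb{P}}\cong\mathbb{F}[x]\rtimes\mathbb{F}^*$, where for all $f\in\mathbb{F}[x]$, $\alpha\in\mathbb{F}^*$: $\tau_{\alpha,(1-\alpha)\lambda}^{-1}\circ\phi_f\circ\tau_{\alpha,(1-\alpha)\lambda}=\phi_g$ with $g(x)=\alpha^{\deg h-1}f(\alpha^{-1}x-(\alpha^{-1}-1)\lambda)$. (b) If $\lambda\notin\mathbb{F}$, then $\mathrm{Aut}_{\mathbb{F}}(A_h)=\{\phi_f:f\in\mathbb{F}[x]\}\cong\mathbb{F}[x]$. Case $k\ge2$: the group $\tau_{\mathbb{P}}/\tau_{1,\mathbb{G}}$ is a finite cyclic group. If $\tau_{\mathbb{P}}\ne\tau_{1,\mathbb{G}}$, then $\tau_{\mathbb{P}}=\tau_{1,\mathbb{G}}\rtimes\langle\tau_{\alpha,\beta}\rangle$ for some $(\alpha,\beta)\in\mathbb{P}$ with $\alpha\ne1$ and either $\alpha^{k-1}=1$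 or $\alpha^k=1$; moreover $\tau_{\alpha,\beta}^{-1}\circ\tau_{1,\nu}\circ\tau_{\alpha,\beta}=\tau_{1,\alpha\nu}$ for all $\nu\in\mathbb{G}$, and $\mathrm{Aut}_{\mathbb{F}}(A_h)\cong N\rtimes\langle\tau_{\alpha,\beta}\rangle$ where $N=\{\phi_f:f\in\mathbb{F}[x]\}\rtimes\tau_{1,\mathbb{G}}$.
   Context: $\mathbb{F}$ is an arbitrary field. For $h\in\mathbb{F}[x]$, $A_h$ is the unital associative $\mathbb{F}$-algebra generated by $x,\hat y$ with defining relation $\hat yx-x\hat y=h$. Let $\mathbb{P}=\{(\alpha,\beta)\in\mathbb{F}^*\times\mathbb{F}: h(\alpha x+\beta)=\alpha^{\deg h}h(x)\}$. For $(\alpha,\beta)\in\mathbb{P}$, $\tau_{\alpha,\beta}$ is the automorphism of $A_h$ with $\tau_{\alpha,\beta}(x)=\alpha x+\beta$, $\tau_{\alpha,\beta}(\hat y)=\alpha^{\deg h-1}\hat y$; $\tau_{\mathbb{P}}=\{\tau_{\alpha,\beta}:(\alpha,\beta)\in\mathbb{P}\}$ is a group. For $f\in\mathbb{F}[x]$, $\phi_f$ is the automorphism with $\phi_f(x)=x$, $\phi_f(\hat y)=\hat y+f$. $\mathbb{G}=\{\nu\in\mathbb{F}:(1,\nu)\in\mathbb{P}\}$ (a finite additive subgroup of $\mathbb{F}$, trivial in characteristic $0$) and $\tau_{1,\mathbb{G}}=\{\tau_{1,\nu}:\nu\in\mathbb{G}\}$, a normal subgroup of $\tau_{\mathbb{P}}$.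 *)

theory Defs
  imports "HOL-Computational_Algebra.Polynomial" "HOL-Algebra.Elementary_Groups"
begin

(* The algebra A_h is modelled by its PBW normal form: an element
   sum_j f_j(x) yhat^j  is the polynomial (in yhat) with coefficients f_j in F[x],
   i.e. an element of type 'a poly poly.  A_h is the Ore extension F[x][yhat; delta]
   with delta = h * d/dx, so  yhat^i g = sum_k (i choose k) delta^k(g) yhat^(i-k). *)

definition ore_delta :: "'a::field poly \<Rightarrow> 'a poly \<Rightarrow> 'a poly" where
  "ore_delta h g = h * pderiv g"

definition amul :: "'a::field poly \<Rightarrow> 'a poly poly \<Rightarrow> 'a poly poly \<Rightarrow> 'a poly poly" where
  "amul h a b = (\<Sum>i\<le>degree a. \<Sum>j\<le>degree b. \<Sum>k\<le>i.
       monom (coeff a i * smult (of_nat (i choose k)) ((ore_delta h ^^ k) (coeff b j))) (i - k + j))"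

definition apow :: "'a::field poly \<Rightarrow> 'a poly poly \<Rightarrow> nat \<Rightarrow> 'a poly poly" where
  "apow h b n = ((\<lambda>c. amul h b c) ^^ n) 1"

definition genX :: "'a::field poly poly" where "genX = [:[:0, 1:]:]"
definition genY :: "'a::field poly poly" where "genY = [:0, 1:]"

definition is_alg_aut :: "'a::field poly \<Rightarrow> ('a poly poly \<Rightarrow> 'a poly poly) \<Rightarrow> bool" where
  "is_alg_aut h \<sigma> \<longleftrightarrow> bij \<sigma>
     \<and> (\<forall>a b. \<sigma> (a + b) = \<sigma> a + \<sigma> b)
     \<and> (\<forall>c a. \<sigma> (smult [:c:] a) = smult [:c:] (\<sigma> a))
     \<and> (\<forall>a b. \<sigma> (amul h a b) = amul h (\<sigma> a) (\<sigma> b))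
     \<and> \<sigma> 1 = 1"

definition AutG :: "'a::field poly \<Rightarrow> ('a poly poly \<Rightarrow> 'a poly poly) monoid" where
  "AutG h = \<lparr>carrier = {\<sigma>. is_alg_aut h \<sigma>}, mult = (\<lambda>\<sigma> \<rho>. \<sigma> \<circ> \<rho>), one = id\<rparr>"

definition Pset :: "'a::field poly \<Rightarrow> ('a \<times> 'a) set" where
  "Pset h = {(\<alpha>, \<beta>). \<alpha> \<noteq> 0 \<and> pcompose h [:\<beta>, \<alpha>:] = smult (\<alpha> ^ degree h) h}"

(* tau_{alpha,beta}: x |-> alpha x + beta, yhat |-> alpha^(deg h - 1) yhat *)
definition tau :: "'a::field poly \<Rightarrow> 'a \<Rightarrow> 'a \<Rightarrow> 'a poly poly \<Rightarrow> 'a poly poly" where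
  "tau h \<alpha> \<beta> a = (\<Sum>j\<le>degree a.
      monom (smult (\<alpha> ^ ((degree h - 1) * j)) (pcompose (coeff a j) [:\<beta>, \<alpha>:])) j)"

(* phi_f: x |-> x, yhat |-> yhat + f *)
definition phi :: "'a::field poly \<Rightarrow> 'a poly \<Rightarrow> 'a poly poly \<Rightarrow> 'a poly poly" where
  "phi h f a = (\<Sum>j\<le>degree a. amul h [:coeff a j:] (apow h (genY + [:f:]) j))"

definition tauP :: "'a::field poly \<Rightarrow> ('a poly poly \<Rightarrow> 'a poly poly) set" where
  "tauP h = (\<lambda>(\<alpha>, \<beta>). tau h \<alpha> \<beta>) ` Pset h"

definition Gset :: "'a::field poly \<Rightarrow> 'a set" where
  "Gset h = {\<nu>. (1, \<nu>) \<in> Pset h}"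

definition tau1G :: "'a::field poly \<Rightarrow> ('a poly poly \<Rightarrow> 'a poly poly) set" where
  "tau1G h = (\<lambda>\<nu>. tau h 1 \<nu>) ` Gset h"

definition phiset :: "'a::field poly \<Rightarrow> ('a poly poly \<Rightarrow> 'a poly poly) set" where
  "phiset h = range (phi h)"

definition is_semidirect :: "('g, 'm) monoid_scheme \<Rightarrow> 'g set \<Rightarrow> 'g set \<Rightarrow> bool" where
  "is_semidirect G N H \<longleftrightarrow> N \<lhd> G \<and> subgroup H G \<and> N \<inter> H = {\<one>\<^bsub>G\<^esub>}
     \<and> N <#>\<^bsub>G\<^esub> H = carrier G"

(* emb : F -> K makes K an algebraic closure of F (K is algebraically closed by its sort) *)
definition is_alg_closure_emb :: "('a::field \<Rightarrow> 'b::alg_closed_field) \<Rightarrow> bool" where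
  "is_alg_closure_emb emb \<longleftrightarrow> inj emb \<and> emb 1 = 1
     \<and> (\<forall>a b. emb (a + b) = emb a + emb b) \<and> (\<forall>a b. emb (a * b) = emb a * emb b)
     \<and> (\<forall>z. \<exists>p. p \<noteq> 0 \<and> poly (map_poly emb p) z = 0)"

end

theory Submission
  imports Defs "HOL-Algebra.Multiplicative_Group"
begin

hide_const (open) up_ring.coeff up_ring.monom module.smult

text \<open>
  Modulo \<open>h\<close> the algebra is commutative and \<open>[y, x] = h\<close>, so the ideal generated by all commutators
  is \<open>h A\<close>. The units of \<open>A\<close> are the nonzero scalars, hence an automorphism \<open>\<sigma>\<close> maps \<open>h\<close> to a scalar
  multiple of itself. Since degrees in \<open>y\<close> add up, this forces \<open>\<sigma> x\<close> to be a polynomial in \<open>x\<close>, then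
  \<open>\<sigma> x = \<alpha> x + \<beta>\<close> with \<open>(\<alpha>, \<beta>) \<in> \<P>\<close>; surjectivity and the defining relation then give
  \<open>\<sigma> y = \<alpha>\<^bsup>deg h - 1\<^esup> y + f\<close>. So every automorphism is \<open>\<phi>\<^sub>f \<circ> \<tau>\<^sub>\<alpha>\<^sub>,\<^sub>\<beta>\<close>. All semidirect products come
  from the homomorphisms \<open>\<phi>\<^sub>f \<circ> \<tau>\<^sub>\<alpha>\<^sub>,\<^sub>\<beta> \<mapsto> \<tau>\<^sub>\<alpha>\<^sub>,\<^sub>\<beta>\<close> and \<open>\<phi>\<^sub>f \<circ> \<tau>\<^sub>\<alpha>\<^sub>,\<^sub>\<beta> \<mapsto> \<alpha>\<close>. An element of \<open>\<P>\<close> acts on the \<open>k\<close>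
  roots of \<open>h\<close> by an affine permutation; for \<open>k \<ge> 2\<close> this makes \<open>\<P>\<close> finite, and the image of \<open>\<alpha>\<close> is a finite,
  hence cyclic, group of units of the field.
\<close>

section \<open>Multiplication in normal form\<close>

text \<open>Left multiplication by \<open>yhat\<close>, from
  \<open>yhat g = g yhat + delta(g)\<close> applied to each coefficient. Iterating this operator
  replaces the triple sum in \<open>amul\<close>.\<close>

definition left_y :: "'a::field poly \<Rightarrow> 'a poly poly \<Rightarrow> 'a poly poly" where
  "left_y h b = pCons 0 b + map_poly (ore_delta h) b"

lemma ore_delta_0 [simp]: "ore_delta h 0 = 0"
  by (simp add: ore_delta_def)

lemma ore_delta_add: "ore_delta h (p + q) = ore_delta h p + ore_delta h q"
  by (simp add: ore_delta_def pderiv_add algebra_simps)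

lemma ore_delta_mult: "ore_delta h (p * q) = ore_delta h p * q + p * ore_delta h q"
  by (simp add: ore_delta_def pderiv_mult algebra_simps)

lemma coeff_left_y:
  "coeff (left_y h b) n = (if n = 0 then 0 else coeff b (n - 1)) + ore_delta h (coeff b n)"
  by (simp add: left_y_def coeff_map_poly coeff_pCons split: nat.split)

lemma left_y_0 [simp]: "left_y h 0 = 0"
  by (simp add: left_y_def)

lemma left_y_add: "left_y h (a + b) = left_y h a + left_y h b"
  by (intro poly_eqI) (simp add: coeff_left_y ore_delta_add)

lemma left_y_smult: "left_y h (smult p b) = smult p (left_y h b) + smult (ore_delta h p) b"
  by (intro poly_eqI) (simp add: coeff_left_y ore_delta_mult algebra_simps)

lemma left_y_funpow_0 [simp]: "(left_y h ^^ i) 0 = 0"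
  by (induction i) auto

lemma left_y_funpow_add: "(left_y h ^^ i) (a + b) = (left_y h ^^ i) a + (left_y h ^^ i) b"
  by (induction i) (auto simp: left_y_add)

lemma left_y_funpow_sum: "(left_y h ^^ i) (sum f A) = (\<Sum>x\<in>A. (left_y h ^^ i) (f x))"
  by (induction A rule: infinite_finite_induct) (auto simp: left_y_funpow_add)

lemma left_y_sum: "left_y h (sum f A) = (\<Sum>x\<in>A. left_y h (f x))"
  using left_y_funpow_sum[of 1] by simp

lemma left_y_monom: "left_y h (monom g j) = monom g (Suc j) + monom (ore_delta h g) j"
  by (simp add: left_y_def map_poly_monom monom_Suc)

text \<open>This connects the operator with the binomial sum in \<open>amul\<close>. One more
  application either raises the exponent or differentiates the coefficient, and Pascal's rule merges
  the two contributions.\<close>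

lemma left_y_funpow_monom:
  "(left_y h ^^ i) (monom g j) =
     (\<Sum>k\<le>i. monom (smult (of_nat (i choose k)) ((ore_delta h ^^ k) g)) (i - k + j))"
proof (induction i)
  case 0
  then show ?case by simp
next
  case (Suc i)
  define D where "D k = (ore_delta h ^^ k) g" for k
  have D: "ore_delta h (smult (of_nat n) (D k)) = smult (of_nat n) (D (Suc k))" for n k
    by (simp add: D_def ore_delta_def pderiv_smult)
  have pascal: "monom (smult (of_nat (Suc i choose Suc k)) p) n =
      monom (smult (of_nat (i choose Suc k)) p) n + monom (smult (of_nat (i choose k)) p) n"
    for k n and p :: "'a poly"
    by (simp add: add_monom smult_add_left add.commute)
  have "(left_y h ^^ Suc i) (monom g j) =
      (\<Sum>k\<le>i. monom (smult (of_nat (i choose k)) (D k)) (Suc i - k + j)) +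
      (\<Sum>k\<le>i. monom (smult (of_nat (i choose k)) (D (Suc k))) (i - k + j))"
    by (simp add: Suc.IH left_y_sum left_y_monom sum.distrib D Suc_diff_le flip: D_def)
  \<comment> \<open>The added top term vanishes since \<open>i choose Suc i = 0\<close>; the longer
    range allows the index shift that aligns this sum with the second one.\<close>
  also have "(\<Sum>k\<le>i. monom (smult (of_nat (i choose k)) (D k)) (Suc i - k + j)) =
      (\<Sum>k\<le>Suc i. monom (smult (of_nat (i choose k)) (D k)) (Suc i - k + j))"
    by (simp add: binomial_eq_0)
  also have "\<dots> = monom (D 0) (Suc i + j) +
      (\<Sum>k\<le>i. monom (smult (of_nat (i choose Suc k)) (D (Suc k))) (i - k + j))"
    by (subst sum.atMost_Suc_shift) simp
  also have "\<dots> + (\<Sum>k\<le>i. monom (smult (of_nat (i choose k)) (D (Suc k))) (i - k + j)) =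
      monom (D 0) (Suc i + j) +
      (\<Sum>k\<le>i. monom (smult (of_nat (Suc i choose Suc k)) (D (Suc k))) (i - k + j))"
    by (simp only: pascal sum.distrib add.assoc)
  also have "\<dots> = (\<Sum>k\<le>Suc i. monom (smult (of_nat (Suc i choose k)) (D k)) (Suc i - k + j))"
    by (subst sum.atMost_Suc_shift) (simp del: binomial_Suc_Suc)
  finally show ?case by (simp add: D_def)
qed

lemma smult_sum_right: "smult c (sum f A) = (\<Sum>x\<in>A. smult c (f x))"
  by (induction A rule: infinite_finite_induct) (auto simp: smult_add_right)

lemma amul_altdef: "amul h a b = (\<Sum>i\<le>degree a. smult (coeff a i) ((left_y h ^^ i) b))"
proof -
  have "(left_y h ^^ i) b = (\<Sum>j\<le>degree b. \<Sum>k\<le>i.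
      monom (smult (of_nat (i choose k)) ((ore_delta h ^^ k) (coeff b j))) (i - k + j))" for i
    by (subst poly_as_sum_of_monoms[of b, symmetric])
       (simp only: left_y_funpow_sum left_y_funpow_monom)
  then show ?thesis
    by (simp add: amul_def smult_sum_right smult_monom)
qed

lemma amul_altdef_le:
  assumes "degree a \<le> n"
  shows "amul h a b = (\<Sum>i\<le>n. smult (coeff a i) ((left_y h ^^ i) b))"
  unfolding amul_altdef using assms
  by (intro sum.mono_neutral_left) (auto simp: coeff_eq_0)

lemma amul_0_left [simp]: "amul h 0 b = 0"
  by (simp add: amul_altdef)

lemma amul_0_right [simp]: "amul h a 0 = 0"
  by (simp add: amul_altdef)

lemma amul_add_left: "amul h (a + a') b = amul h a b + amul h a' b"
proof -
  let ?n = "max (degree a) (degree a')"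
  have "amul h (a + a') b = (\<Sum>i\<le>?n. smult (coeff (a + a') i) ((left_y h ^^ i) b))"
    by (rule amul_altdef_le) (rule degree_add_le_max)
  also have "\<dots> = amul h a b + amul h a' b"
    by (simp only: coeff_add smult_add_left sum.distrib amul_altdef_le[of a ?n] amul_altdef_le[of a' ?n]
        max.cobounded1 max.cobounded2)
  finally show ?thesis .
qed

lemma amul_add_right: "amul h a (b + b') = amul h a b + amul h a b'"
  by (simp add: amul_altdef left_y_funpow_add smult_add_right sum.distrib)

lemma amul_smult_left: "amul h (smult p a) b = smult p (amul h a b)"
  by (simp add: amul_altdef smult_sum_right amul_altdef_le[of "smult p a" "degree a"] degree_smult_le)

lemma amul_const_left: "amul h [:p:] b = smult p b"
  by (simp add: amul_altdef)

text \<open>Reading \<open>pCons p a\<close> as \<open>p + a yhat\<close> lets the factor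
  \<open>yhat\<close> act on \<open>b\<close>. This recursion on the left factor carries nearly all
  later inductions.\<close>

lemma amul_pCons: "amul h (pCons p a) b = smult p b + amul h a (left_y h b)"
proof -
  have "amul h (pCons p a) b =
      (\<Sum>i\<le>Suc (degree a). smult (coeff (pCons p a) i) ((left_y h ^^ i) b))"
    by (rule amul_altdef_le) (rule degree_pCons_le)
  then show ?thesis
    by (simp add: sum.atMost_Suc_shift funpow_swap1 amul_altdef del: sum.atMost_Suc)
qed

text \<open>The case of associativity with \<open>yhat\<close> as first factor. It is where the
  product rule for \<open>ore_delta\<close> enters; general associativity then follows by the
  recursion on the left factor.\<close>

lemma amul_left_y: "amul h (left_y h a) b = left_y h (amul h a b)"
proof (induction a arbitrary: b)
  case 0
  then show ?case by simp
next
  case (pCons p a)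
  have "left_y h (pCons p a) = pCons 0 (pCons p a) + pCons (ore_delta h p) (map_poly (ore_delta h) a)"
    by (simp add: left_y_def map_poly_pCons)
  also have "\<dots> = pCons (ore_delta h p) (left_y h a) + pCons 0 [:p:]"
    by (simp add: left_y_def)
  finally show ?case
    by (simp add: amul_pCons amul_add_left pCons.IH left_y_add left_y_smult)
qed

lemma amul_assoc: "amul h (amul h a b) c = amul h a (amul h b c)"
  by (induction a arbitrary: b) (simp_all add: amul_pCons amul_add_left amul_smult_left amul_left_y)

lemma amul_1_left [simp]: "amul h 1 b = b"
  using amul_const_left[of h 1 b] by (simp flip: one_pCons)

lemma left_y_monom_1: "left_y h (monom 1 n) = monom 1 (Suc n)"
  by (simp add: left_y_monom ore_delta_def)

lemma left_y_funpow_monom_1: "(left_y h ^^ i) (monom 1 n) = monom 1 (i + n)"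
  by (induction i) (auto simp: left_y_monom_1)

text \<open>Powers of \<open>yhat\<close> have constant coefficients, which \<open>ore_delta\<close>
  kills, so multiplying by them on the right is a mere shift.\<close>

lemma amul_monom_1_right: "amul h a (monom 1 n) = a * monom 1 n"
proof -
  have "amul h a (monom 1 n) = (\<Sum>i\<le>degree a. monom (coeff a i) i) * monom 1 n"
    by (simp add: amul_altdef left_y_funpow_monom_1 smult_monom sum_distrib_right mult_monom)
  then show ?thesis
    by (simp add: poly_as_sum_of_monoms)
qed

lemma amul_1_right [simp]: "amul h a 1 = a"
  using amul_monom_1_right[of h a 0] by simp

lemma genY_eq_monom: "genY = monom 1 1"
  by (simp add: genY_def monom_Suc)

lemma amul_genY_right: "amul h a genY = pCons 0 a"
  unfolding genY_eq_monom amul_monom_1_right by (simp add: monom_Suc)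

lemma amul_genY_left: "amul h genY b = left_y h b"
  by (simp add: genY_def amul_pCons amul_const_left)

lemma amul_smult_const_right: "amul h a (smult [:c:] b) = smult [:c:] (amul h a b)"
proof (induction a arbitrary: b)
  case 0
  then show ?case by simp
next
  case (pCons p a)
  have "left_y h (smult [:c:] b) = smult [:c:] (left_y h b)"
    by (simp add: left_y_smult ore_delta_def)
  then show ?case
    by (simp add: amul_pCons pCons.IH smult_add_right mult.commute)
qed

lemma amul_const_const: "amul h [:p:] [:q:] = [:p * q:]"
  by (simp add: amul_const_left)

lemma degree_left_y:
  assumes "b \<noteq> 0"
  shows "degree (left_y h b) = Suc (degree b)" "coeff (left_y h b) (Suc (degree b)) = lead_coeff b"
proof -
  show "coeff (left_y h b) (Suc (degree b)) = lead_coeff b"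
    by (simp add: coeff_left_y coeff_eq_0)
  with assms show "degree (left_y h b) = Suc (degree b)"
    by (intro antisym degree_le le_degree) (auto simp: coeff_left_y coeff_eq_0)
qed

lemma left_y_eq_0_iff [simp]: "left_y h b = 0 \<longleftrightarrow> b = 0"
  using degree_left_y(1)[of b h] by (cases "b = 0") auto

text \<open>In the recursion the summand with \<open>left_y h b\<close> has strictly larger degree
  in \<open>yhat\<close> than \<open>smult p b\<close>, so nothing cancels. Hence the algebra is a
  domain with additive degree.\<close>

lemma degree_amul:
  assumes "a \<noteq> 0" "b \<noteq> 0"
  shows "degree (amul h a b) = degree a + degree b \<and> amul h a b \<noteq> 0"
  using assms
proof (induction a arbitrary: b)
  case 0
  then show ?case by simp
next
  case (pCons p a)
  show ?case
  proof (cases "a = 0")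
    case True
    then show ?thesis using pCons by (simp add: amul_const_left)
  next
    case False
    then have IH: "degree (amul h a (left_y h b)) = degree a + Suc (degree b)"
      using pCons.IH[of "left_y h b"] pCons.prems by (simp add: degree_left_y)
    have "degree (amul h (pCons p a) b) = degree a + Suc (degree b)"
      unfolding amul_pCons
      by (subst degree_add_eq_right) (use IH degree_smult_le[of p b] in auto)
    then show ?thesis using False by auto
  qed
qed

text \<open>All values of \<open>ore_delta h\<close> are multiples of \<open>h\<close>, so modulo
  \<open>h\<close> the operator \<open>left_y\<close> is ordinary multiplication by the variable and
  the product is the commutative one.\<close>

lemma amul_mod: "\<exists>w. amul h a b = a * b + smult h w"
proof (induction a arbitrary: b)
  case 0
  then show ?case by (intro exI[of _ 0]) simp
next
  case (pCons p a)
  obtain w where w: "amul h a (left_y h b) = a * left_y h b + smult h w"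
    using pCons.IH by blast
  have y: "left_y h b = pCons 0 b + smult h (map_poly pderiv b)"
    by (intro poly_eqI) (simp add: coeff_left_y coeff_map_poly ore_delta_def coeff_pCons split: nat.split)
  have "amul h (pCons p a) b = pCons p a * b + smult h (a * map_poly pderiv b + w)"
    unfolding amul_pCons w unfolding y by (simp add: algebra_simps smult_add_right)
  then show ?case by blast
qed

lemma commutator_mod: "\<exists>w. amul h a b - amul h b a = smult h w"
proof -
  obtain v w where "amul h a b = a * b + smult h v" "amul h b a = b * a + smult h w"
    using amul_mod by meson
  then have "amul h a b - amul h b a = smult h (v - w)"
    by (simp add: smult_diff_right mult.commute)
  then show ?thesis by blast
qed

lemma genY_genX: "amul h genY genX - amul h genX genY = [:h:]"
  by (simp add: amul_genY_left amul_genY_right genX_def left_y_def map_poly_pCons ore_delta_def pderiv_pCons)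

section \<open>Algebra homomorphisms and their values on the generators\<close>

definition alg_hom :: "'a::field poly \<Rightarrow> ('a poly poly \<Rightarrow> 'a poly poly) \<Rightarrow> bool" where
  "alg_hom h \<sigma> \<longleftrightarrow> (\<forall>a b. \<sigma> (a + b) = \<sigma> a + \<sigma> b)
     \<and> (\<forall>c a. \<sigma> (smult [:c:] a) = smult [:c:] (\<sigma> a))
     \<and> (\<forall>a b. \<sigma> (amul h a b) = amul h (\<sigma> a) (\<sigma> b))
     \<and> \<sigma> 1 = 1"

lemma is_alg_aut_iff: "is_alg_aut h \<sigma> \<longleftrightarrow> bij \<sigma> \<and> alg_hom h \<sigma>"
  by (auto simp: is_alg_aut_def alg_hom_def)

lemma alg_homD:
  assumes "alg_hom h \<sigma>"
  shows "\<sigma> (a + b) = \<sigma> a + \<sigma> b" "\<sigma> (smult [:c:] a) = smult [:c:] (\<sigma> a)"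
    "\<sigma> (amul h a b) = amul h (\<sigma> a) (\<sigma> b)" "\<sigma> 1 = 1" "\<sigma> 0 = 0" "\<sigma> (a - b) = \<sigma> a - \<sigma> b"
    "\<sigma> [:[:c:]:] = [:[:c:]:]"
proof -
  show add: "\<sigma> (a + b) = \<sigma> a + \<sigma> b" for a b using assms by (simp add: alg_hom_def)
  show sm: "\<sigma> (smult [:c:] a) = smult [:c:] (\<sigma> a)" for c a using assms by (simp add: alg_hom_def)
  show "\<sigma> (amul h a b) = amul h (\<sigma> a) (\<sigma> b)" using assms by (simp add: alg_hom_def)
  show one: "\<sigma> 1 = 1" using assms by (simp add: alg_hom_def)
  show "\<sigma> 0 = 0" using sm[of 0 0] by simp
  show "\<sigma> (a - b) = \<sigma> a - \<sigma> b" using add[of "a - b" b] by (simp add: algebra_simps)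
  show "\<sigma> [:[:c:]:] = [:[:c:]:]" using sm[of c 1] one by (simp add: one_pCons)
qed

lemma alg_hom_comp: "alg_hom h \<sigma> \<Longrightarrow> alg_hom h \<rho> \<Longrightarrow> alg_hom h (\<sigma> \<circ> \<rho>)"
  by (simp add: alg_hom_def)

lemma alg_hom_id: "alg_hom h id"
  by (simp add: alg_hom_def)

lemma const_pCons_eq: "[:pCons c p:] = [:[:c:]:] + amul h genX [:p:]"
  by (simp add: genX_def amul_const_left)

lemma pCons_eq_amul_genY: "pCons p a = [:p:] + amul h a genY"
  by (simp add: amul_genY_right)

lemma alg_hom_const_pCons:
  assumes "alg_hom h \<sigma>"
  shows "\<sigma> [:pCons c p:] = [:[:c:]:] + amul h (\<sigma> genX) (\<sigma> [:p:])"
  by (subst const_pCons_eq[of c p h]) (simp add: alg_homD[OF assms])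

lemma alg_hom_pCons:
  assumes "alg_hom h \<sigma>"
  shows "\<sigma> (pCons p a) = \<sigma> [:p:] + amul h (\<sigma> a) (\<sigma> genY)"
  by (subst pCons_eq_amul_genY[of p a h]) (simp add: alg_homD[OF assms])

text \<open>The two generators determine a homomorphism: first on \<open>F[x]\<close> by Horner's
  scheme, then on normal forms in \<open>yhat\<close>. All later identities between
  \<open>phi\<close> and \<open>tau\<close> are checked in this way.\<close>

lemma alg_hom_eqI:
  assumes "alg_hom h \<sigma>" "alg_hom h \<rho>" "\<sigma> genX = \<rho> genX" "\<sigma> genY = \<rho> genY"
  shows "\<sigma> = \<rho>"
proof
  have c: "\<sigma> [:p:] = \<rho> [:p:]" for p
    by (induction p)
       (simp_all add: alg_homD[OF assms(1)] alg_homD[OF assms(2)]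
         alg_hom_const_pCons[OF assms(1)] alg_hom_const_pCons[OF assms(2)] assms(3))
  show "\<sigma> a = \<rho> a" for a
  proof (induction a)
    case 0
    then show ?case by (simp add: alg_homD[OF assms(1)] alg_homD[OF assms(2)])
  next
    case (pCons p a)
    then show ?case
      unfolding alg_hom_pCons[OF assms(1), of p a] alg_hom_pCons[OF assms(2), of p a] by (simp add: c assms(4))
  qed
qed

lemma alg_hom_const:
  assumes "alg_hom h \<sigma>" "\<sigma> genX = [:q:]"
  shows "\<sigma> [:p:] = [:pcompose p q:]"
  by (induction p)
     (simp_all add: alg_homD[OF assms(1)] alg_hom_const_pCons[OF assms(1)] assms(2)
       amul_const_const pcompose_pCons)

text \<open>In Horner's scheme each multiplication by the image of \<open>x\<close> adds its
  positive degree, and the added scalar cannot interfere. The lemma serves to show that an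
  automorphism sends \<open>x\<close> into \<open>F[x]\<close>.\<close>

lemma degree_alg_hom_const:
  assumes "alg_hom h \<sigma>" "degree (\<sigma> genX) > 0" "p \<noteq> 0"
  shows "degree (\<sigma> [:p:]) = degree p * degree (\<sigma> genX) \<and> \<sigma> [:p:] \<noteq> 0"
  using assms(3)
proof (induction p)
  case 0
  then show ?case by simp
next
  case (pCons c p)
  show ?case
  proof (cases "p = 0")
    case True
    then show ?thesis using pCons by (simp add: alg_homD[OF assms(1)])
  next
    case False
    have nz: "\<sigma> genX \<noteq> 0" using assms(2) by auto
    have "degree (amul h (\<sigma> genX) (\<sigma> [:p:])) = Suc (degree p) * degree (\<sigma> genX)"
      using degree_amul[OF nz, of "\<sigma> [:p:]" h] pCons.IH[OF False] by simp
    then have "degree (\<sigma> [:pCons c p:]) = Suc (degree p) * degree (\<sigma> genX)"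
      unfolding alg_hom_const_pCons[OF assms(1)]
      by (subst degree_add_eq_right) (use assms(2) in auto)
    moreover from this have "\<sigma> [:pCons c p:] \<noteq> 0"
      using assms(2) by (intro notI) simp
    ultimately show ?thesis using False by simp
  qed
qed

text \<open>The same degree count with \<open>yhat\<close> in place of \<open>x\<close>:
  coefficients stay in \<open>F[x]\<close>, of degree 0 in \<open>yhat\<close>, and do not vanish
  because \<open>q\<close> is not constant. Applied to a preimage of \<open>yhat\<close>, it bounds
  the degree of the image of \<open>yhat\<close>.\<close>

lemma degree_alg_hom:
  assumes "alg_hom h \<sigma>" "\<sigma> genX = [:q:]" "degree q > 0" "degree (\<sigma> genY) > 0" "a \<noteq> 0"
  shows "degree (\<sigma> a) = degree a * degree (\<sigma> genY) \<and> \<sigma> a \<noteq> 0"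
  using assms(5)
proof (induction a)
  case 0
  then show ?case by simp
next
  case (pCons p a)
  have c: "\<sigma> [:p:] = [:pcompose p q:]" for p
    by (rule alg_hom_const[OF assms(1,2)])
  show ?case
  proof (cases "a = 0")
    case True
    then show ?thesis using pCons assms(3) by (simp add: c pcompose_eq_0_iff)
  next
    case False
    have nz: "\<sigma> genY \<noteq> 0" using assms(4) by auto
    have "degree (amul h (\<sigma> a) (\<sigma> genY)) = Suc (degree a) * degree (\<sigma> genY)"
      using degree_amul[OF _ nz, of "\<sigma> a" h] pCons.IH[OF False] by simp
    then have "degree (\<sigma> (pCons p a)) = Suc (degree a) * degree (\<sigma> genY)"
      unfolding alg_hom_pCons[OF assms(1), of p a] c
      by (subst degree_add_eq_right) (use assms(4) in auto)
    moreover from this have "\<sigma> (pCons p a) \<noteq> 0"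
      using assms(4) by (intro notI) simp
    ultimately show ?thesis using False by simp
  qed
qed

section \<open>Automorphisms\<close>

text \<open>A universal property: \<open>q\<close> and \<open>w\<close> are the images of
  \<open>x\<close> and \<open>yhat\<close>, \<open>rec\<close> is evaluation of the normal form, and
  \<open>comm\<close> is the image of the relation \<open>yhat p = p yhat + delta(p)\<close> for
  every \<open>p\<close> in \<open>F[x]\<close>.\<close>

lemma alg_homI:
  assumes zero: "\<sigma> 0 = 0"
    and rec: "\<And>p a. \<sigma> (pCons p a) = [:pcompose p q:] + amul h (\<sigma> a) w"
    and comm: "\<And>p. amul h w [:pcompose p q:] = smult (pcompose p q) w + [:pcompose (ore_delta h p) q:]"
  shows "alg_hom h \<sigma>"
proof -
  have add: "\<sigma> (a + b) = \<sigma> a + \<sigma> b" for a b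
    by (induction a b rule: poly_induct2) (simp_all add: zero rec amul_add_left pcompose_add)
  have smult: "\<sigma> (smult p a) = smult (pcompose p q) (\<sigma> a)" for p a
    by (induction a) (simp_all add: zero rec pcompose_mult smult_add_right amul_smult_left)
  have const: "\<sigma> [:p:] = [:pcompose p q:]" for p
    by (simp add: rec zero)
  \<comment> \<open>Multiplicativity is first shown for the left factor \<open>yhat\<close>, where
    \<open>comm\<close> is needed; the general case is then a recursion on the left factor.\<close>
  have y: "\<sigma> (left_y h a) = amul h w (\<sigma> a)" for a
  proof (induction a)
    case 0
    then show ?case by (simp add: zero)
  next
    case (pCons p a)
    have "left_y h (pCons p a) = pCons (ore_delta h p) (left_y h a) + pCons 0 [:p:]"
      by (simp add: left_y_def map_poly_pCons)
    then have "\<sigma> (left_y h (pCons p a)) = [:pcompose (ore_delta h p) q:]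
        + amul h (amul h w (\<sigma> a)) w + smult (pcompose p q) w"
      by (simp add: add rec pCons.IH zero amul_add_left amul_const_left)
    also have "\<dots> = amul h w (\<sigma> (pCons p a))"
      by (simp add: rec amul_add_right comm amul_assoc)
    finally show ?case .
  qed
  have mult: "\<sigma> (amul h a b) = amul h (\<sigma> a) (\<sigma> b)" for a b
    by (induction a arbitrary: b)
       (simp_all add: zero amul_pCons add smult y rec amul_add_left amul_const_left amul_assoc)
  have "\<sigma> 1 = 1"
    using const[of 1] by (simp add: pcompose_1 flip: one_pCons)
  then show ?thesis
    by (simp add: alg_hom_def add smult mult)
qed

lemma coeff_tau:
  "coeff (tau h \<alpha> \<beta> a) n = smult (\<alpha> ^ ((degree h - 1) * n)) (pcompose (coeff a n) [:\<beta>, \<alpha>:])"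
  by (simp add: tau_def coeff_sum sum.delta if_distrib coeff_eq_0 cong: if_cong)

lemma alg_hom_tau:
  assumes "(\<alpha>, \<beta>) \<in> Pset h" "degree h > 0"
  shows "alg_hom h (tau h \<alpha> \<beta>)"
proof (rule alg_homI[where q = "[:\<beta>, \<alpha>:]" and w = "smult [:\<alpha> ^ (degree h - 1):] genY"])
  show "tau h \<alpha> \<beta> 0 = 0"
    by (rule poly_eqI) (simp add: coeff_tau)
  show "tau h \<alpha> \<beta> (pCons p a) =
      [:pcompose p [:\<beta>, \<alpha>:]:] + amul h (tau h \<alpha> \<beta> a) (smult [:\<alpha> ^ (degree h - 1):] genY)" for p a
    by (rule poly_eqI)
       (simp add: coeff_tau amul_smult_const_right amul_genY_right coeff_pCons power_add mult.commute split: nat.split)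
  \<comment> \<open>The image of \<open>yhat\<close> contributes \<alpha> to the power
    \<open>degree h - 1\<close> and the chain rule one more \<alpha>. Since the degree is positive,
    these give exactly the factor in the definition of \<open>Pset\<close>.\<close>
  have *: "smult (\<alpha> ^ (degree h - 1) * \<alpha>) h = pcompose h [:\<beta>, \<alpha>:]"
    using assms by (simp add: Pset_def flip: power_Suc2)
  show "amul h (smult [:\<alpha> ^ (degree h - 1):] genY) [:pcompose p [:\<beta>, \<alpha>:]:] =
      smult (pcompose p [:\<beta>, \<alpha>:]) (smult [:\<alpha> ^ (degree h - 1):] genY)
        + [:pcompose (ore_delta h p) [:\<beta>, \<alpha>:]:]" for p
    by (simp add: genY_def amul_pCons amul_const_left left_y_def map_poly_pCons ore_delta_def
        pderiv_pcompose pderiv_pCons pcompose_mult mult.commute flip: *)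
qed

text \<open>\<open>apow\<close> multiplies by new factors on the left, whereas the recursion in
  \<open>alg_homI\<close> appends them on the right; associativity reconciles the two.\<close>

lemma apow_Suc: "apow h b (Suc n) = amul h (apow h b n) b"
proof -
  have "apow h b (Suc n) = amul h b (apow h b n)" for n
    by (simp add: apow_def)
  then show ?thesis
    by (induction n) (simp_all add: apow_def flip: amul_assoc)
qed

lemma phi_le:
  assumes "degree a \<le> n"
  shows "phi h f a = (\<Sum>j\<le>n. smult (coeff a j) (apow h (genY + [:f:]) j))"
  unfolding phi_def amul_const_left using assms
  by (intro sum.mono_neutral_left) (auto simp: coeff_eq_0)

lemma amul_sum_left: "amul h (sum g A) b = (\<Sum>x\<in>A. amul h (g x) b)"
  by (induction A rule: infinite_finite_induct) (auto simp: amul_add_left)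

text \<open>Adding an element of the commutative ring \<open>F[x]\<close> to \<open>yhat\<close>
  leaves its commutators with \<open>F[x]\<close> unchanged, so the defining relation
  survives.\<close>

lemma alg_hom_phi: "alg_hom h (phi h f)"
proof (rule alg_homI[where q = "[:0, 1:]" and w = "genY + [:f:]"])
  show "phi h f 0 = 0"
    by (simp add: phi_def amul_const_left)
  show "phi h f (pCons p a) = [:pcompose p [:0, 1:]:] + amul h (phi h f a) (genY + [:f:])" for p a
  proof -
    have "phi h f (pCons p a) =
        (\<Sum>j\<le>Suc (degree a). smult (coeff (pCons p a) j) (apow h (genY + [:f:]) j))"
      by (rule phi_le) (rule degree_pCons_le)
    also have "\<dots> = [:p:] + amul h (phi h f a) (genY + [:f:])"
      by (simp add: sum.atMost_Suc_shift phi_le[OF order.refl] apow_Suc amul_sum_left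
          amul_smult_left apow_def[of _ _ 0] del: sum.atMost_Suc)
    finally show ?thesis by simp
  qed
  show "amul h (genY + [:f:]) [:pcompose p [:0, 1:]:] =
      smult (pcompose p [:0, 1:]) (genY + [:f:]) + [:pcompose (ore_delta h p) [:0, 1:]:]" for p
    by (simp add: genY_def amul_pCons amul_const_left left_y_def map_poly_pCons mult.commute)
qed

lemma tau_genX: "tau h \<alpha> \<beta> genX = [:[:\<beta>, \<alpha>:]:]"
  by (rule poly_eqI) (simp add: coeff_tau genX_def coeff_pCons pcompose_pCons split: nat.split)

lemma tau_genY: "tau h \<alpha> \<beta> genY = smult [:\<alpha> ^ (degree h - 1):] genY"
  by (rule poly_eqI) (simp add: coeff_tau genY_def coeff_pCons pcompose_1 split: nat.split)

lemma tau_const: "tau h \<alpha> \<beta> [:p:] = [:pcompose p [:\<beta>, \<alpha>:]:]"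
  by (rule poly_eqI) (simp add: coeff_tau coeff_pCons split: nat.split)

lemma phi_const: "phi h f [:p:] = [:p:]"
  by (simp add: phi_def amul_const_left apow_def)

lemma phi_genX: "phi h f genX = genX"
  by (simp add: genX_def phi_const)

lemma phi_genY: "phi h f genY = genY + [:f:]"
  by (simp add: phi_def genY_def amul_const_left apow_def)

lemma inj_phi: "inj (phi h)"
proof (rule injI)
  fix f g assume "phi h f = phi h g"
  then have "phi h f genY = phi h g genY" by simp
  then show "f = g" by (simp add: phi_genY)
qed

lemma tau_eq_iff: "tau h \<alpha> \<beta> = tau h \<alpha>' \<beta>' \<longleftrightarrow> \<alpha> = \<alpha>' \<and> \<beta> = \<beta>'"
proof
  assume "tau h \<alpha> \<beta> = tau h \<alpha>' \<beta>'"
  then have "tau h \<alpha> \<beta> genX = tau h \<alpha>' \<beta>' genX" by simp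
  then show "\<alpha> = \<alpha>' \<and> \<beta> = \<beta>'" by (simp add: tau_genX)
qed simp

lemma phi_comp_phi: "phi h f \<circ> phi h g = phi h (f + g)"
  by (rule alg_hom_eqI[of h])
     (simp_all add: alg_hom_comp alg_hom_phi phi_genX phi_genY alg_homD(1)[OF alg_hom_phi] phi_const)

lemma phi_0: "phi h 0 = id"
  by (rule alg_hom_eqI[of h]) (simp_all add: alg_hom_id alg_hom_phi phi_genX phi_genY)

lemma tau_1_0: "tau h 1 0 = id"
proof
  show "tau h 1 0 a = id a" for a
    by (rule poly_eqI) (simp add: coeff_tau)
qed

lemma Pset_1_0: "(1, 0) \<in> Pset h"
  by (simp add: Pset_def)

text \<open>The order of the product is that of composing automorphisms: the second map sends
  \<open>x\<close> to \<open>\<alpha>2 x + \<beta>2\<close>, and the first then substitutes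
  \<open>\<alpha>1 x + \<beta>1\<close>.\<close>

lemma Pset_mult:
  assumes "(\<alpha>1, \<beta>1) \<in> Pset h" "(\<alpha>2, \<beta>2) \<in> Pset h"
  shows "(\<alpha>1 * \<alpha>2, \<alpha>2 * \<beta>1 + \<beta>2) \<in> Pset h"
proof -
  have "[:\<alpha>2 * \<beta>1 + \<beta>2, \<alpha>1 * \<alpha>2:] = pcompose [:\<beta>2, \<alpha>2:] [:\<beta>1, \<alpha>1:]"
    by (simp add: pcompose_pCons algebra_simps)
  then show ?thesis
    using assms by (simp add: Pset_def pcompose_assoc pcompose_smult power_mult_distrib mult.commute)
qed

lemma Pset_inverse:
  assumes "(\<alpha>, \<beta>) \<in> Pset h"
  shows "(inverse \<alpha>, - (\<beta> * inverse \<alpha>)) \<in> Pset h"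
proof -
  have \<alpha>: "\<alpha> \<noteq> 0" and h: "pcompose h [:\<beta>, \<alpha>:] = smult (\<alpha> ^ degree h) h"
    using assms by (auto simp: Pset_def)
  have "pcompose [:\<beta>, \<alpha>:] [:- (\<beta> * inverse \<alpha>), inverse \<alpha>:] = [:0, 1:]"
    using \<alpha> by (simp add: pcompose_pCons)
  then have "h = pcompose (pcompose h [:\<beta>, \<alpha>:]) [:- (\<beta> * inverse \<alpha>), inverse \<alpha>:]"
    by (simp flip: pcompose_assoc)
  then have "h = smult (\<alpha> ^ degree h) (pcompose h [:- (\<beta> * inverse \<alpha>), inverse \<alpha>:])"
    by (simp only: h pcompose_smult)
  then have "smult (inverse \<alpha> ^ degree h) h = smult (inverse \<alpha> ^ degree h)
      (smult (\<alpha> ^ degree h) (pcompose h [:- (\<beta> * inverse \<alpha>), inverse \<alpha>:]))"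
    by simp
  also have "\<dots> = pcompose h [:- (\<beta> * inverse \<alpha>), inverse \<alpha>:]"
    using \<alpha> by (simp flip: power_mult_distrib)
  finally have "smult (inverse \<alpha> ^ degree h) h = pcompose h [:- (\<beta> * inverse \<alpha>), inverse \<alpha>:]" .
  then show ?thesis
    using \<alpha> by (simp add: Pset_def)
qed

lemma tau_comp_tau:
  assumes "(\<alpha>1, \<beta>1) \<in> Pset h" "(\<alpha>2, \<beta>2) \<in> Pset h" "degree h > 0"
  shows "tau h \<alpha>1 \<beta>1 \<circ> tau h \<alpha>2 \<beta>2 = tau h (\<alpha>1 * \<alpha>2) (\<alpha>2 * \<beta>1 + \<beta>2)"
proof (rule alg_hom_eqI[of h])
  show "alg_hom h (tau h (\<alpha>1 * \<alpha>2) (\<alpha>2 * \<beta>1 + \<beta>2))"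
    by (intro alg_hom_tau Pset_mult assms)
qed (simp_all add: alg_hom_comp alg_hom_tau assms tau_genX tau_genY tau_const
    alg_homD(2)[OF alg_hom_tau] pcompose_pCons power_mult_distrib mult.commute add.commute)

lemma tau_inverse:
  assumes "(\<alpha>, \<beta>) \<in> Pset h" "degree h > 0"
  shows "tau h \<alpha> \<beta> \<circ> tau h (inverse \<alpha>) (- (\<beta> * inverse \<alpha>)) = id"
    and "tau h (inverse \<alpha>) (- (\<beta> * inverse \<alpha>)) \<circ> tau h \<alpha> \<beta> = id"
proof -
  have "\<alpha> \<noteq> 0" using assms by (simp add: Pset_def)
  then show "tau h \<alpha> \<beta> \<circ> tau h (inverse \<alpha>) (- (\<beta> * inverse \<alpha>)) = id"
    "tau h (inverse \<alpha>) (- (\<beta> * inverse \<alpha>)) \<circ> tau h \<alpha> \<beta> = id"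
    by (simp_all add: tau_comp_tau assms Pset_inverse tau_1_0 mult.left_commute[of \<alpha>])
qed

text \<open>Both sides must send \<open>yhat\<close> to \<alpha> to the power
  \<open>degree h - 1\<close> times \<open>yhat + f\<close>. Since \<open>tau\<close> acts on
  \<open>F[x]\<close> by an affine substitution, the polynomial on the right is found by undoing
  that substitution.\<close>

lemma phi_comp_tau:
  assumes "(\<alpha>, \<beta>) \<in> Pset h" "degree h > 0"
  shows "phi h f \<circ> tau h \<alpha> \<beta> = tau h \<alpha> \<beta> \<circ>
    phi h (smult (\<alpha> ^ (degree h - 1)) (pcompose f [:- (\<beta> * inverse \<alpha>), inverse \<alpha>:]))"
proof (rule alg_hom_eqI[of h])
  have \<alpha>: "\<alpha> \<noteq> 0" using assms by (simp add: Pset_def)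
  have l: "pcompose (pcompose f [:- (\<beta> * inverse \<alpha>), inverse \<alpha>:]) [:\<beta>, \<alpha>:] = f"
    using \<alpha> by (simp add: pcompose_pCons flip: pcompose_assoc)
  let ?g = "smult (\<alpha> ^ (degree h - 1)) (pcompose f [:- (\<beta> * inverse \<alpha>), inverse \<alpha>:])"
  show "(phi h f \<circ> tau h \<alpha> \<beta>) genX = (tau h \<alpha> \<beta> \<circ> phi h ?g) genX"
    by (simp add: phi_genX tau_genX phi_const)
  show "(phi h f \<circ> tau h \<alpha> \<beta>) genY = (tau h \<alpha> \<beta> \<circ> phi h ?g) genY"
    by (simp add: phi_genY tau_genY alg_homD(2)[OF alg_hom_phi] alg_homD(1)[OF alg_hom_tau[OF assms]]
        smult_add_right tau_const pcompose_smult l)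
qed (use assms in \<open>simp_all add: alg_hom_comp alg_hom_phi alg_hom_tau\<close>)

lemma tau_comp_phi:
  assumes "(\<alpha>, \<beta>) \<in> Pset h" "degree h > 0"
  shows "\<exists>g. tau h \<alpha> \<beta> \<circ> phi h f = phi h g \<circ> tau h \<alpha> \<beta>"
proof -
  let ?c = "inverse (\<alpha> ^ (degree h - 1))"
  have \<alpha>: "\<alpha> \<noteq> 0" using assms by (simp add: Pset_def)
  have "pcompose (pcompose f [:\<beta>, \<alpha>:]) [:- (\<beta> * inverse \<alpha>), inverse \<alpha>:] = f"
    using \<alpha> by (simp add: pcompose_pCons mult.left_commute[of \<alpha>] flip: pcompose_assoc)
  then have "phi h (smult ?c (pcompose f [:\<beta>, \<alpha>:])) \<circ> tau h \<alpha> \<beta> = tau h \<alpha> \<beta> \<circ> phi h f"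
    using \<alpha> by (simp add: phi_comp_tau assms pcompose_smult)
  then show ?thesis by (intro exI) (rule sym)
qed

lemma bij_phi: "bij (phi h f)"
  by (rule o_bij[of "phi h (- f)"]) (simp_all add: phi_comp_phi phi_0)

lemma bij_tau:
  assumes "(\<alpha>, \<beta>) \<in> Pset h" "degree h > 0"
  shows "bij (tau h \<alpha> \<beta>)"
  using tau_inverse[OF assms] by (intro o_bij)

lemma inv_tau:
  assumes "(\<alpha>, \<beta>) \<in> Pset h" "degree h > 0"
  shows "inv_into UNIV (tau h \<alpha> \<beta>) = tau h (inverse \<alpha>) (- (\<beta> * inverse \<alpha>))"
  using tau_inverse[OF assms] by (intro inv_unique_comp)

lemma is_alg_aut_phi: "is_alg_aut h (phi h f)"
  by (simp add: is_alg_aut_iff bij_phi alg_hom_phi)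

lemma is_alg_aut_tau:
  assumes "(\<alpha>, \<beta>) \<in> Pset h" "degree h > 0"
  shows "is_alg_aut h (tau h \<alpha> \<beta>)"
  by (simp add: is_alg_aut_iff bij_tau alg_hom_tau assms)

lemma is_alg_aut_comp: "is_alg_aut h \<sigma> \<Longrightarrow> is_alg_aut h \<rho> \<Longrightarrow> is_alg_aut h (\<sigma> \<circ> \<rho>)"
  by (simp add: is_alg_aut_iff bij_comp alg_hom_comp)

lemma is_alg_aut_inv:
  assumes "is_alg_aut h \<sigma>"
  shows "is_alg_aut h (inv_into UNIV \<sigma>)"
proof -
  have b: "bij \<sigma>" and s: "alg_hom h \<sigma>" using assms by (auto simp: is_alg_aut_iff)
  note * = alg_homD[OF s] surj_f_inv_f[OF bij_is_surj[OF b]] inv_f_f[OF bij_is_inj[OF b]]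
  have "alg_hom h (inv_into UNIV \<sigma>)"
    unfolding alg_hom_def
    by (intro conjI allI; rule inv_f_eq[OF bij_is_inj[OF b]]) (simp_all add: *)
  then show ?thesis using b by (simp add: is_alg_aut_iff bij_imp_bij_inv)
qed

section \<open>Classification of the automorphisms\<close>

lemma alg_aut_h:
  assumes "is_alg_aut h \<sigma>" "h \<noteq> 0"
  obtains c where "c \<noteq> 0" "\<sigma> [:h:] = [:smult c h:]"
proof -
  \<comment> \<open>The image of \<open>h\<close> is the commutator of the images of
    \<open>yhat\<close> and \<open>x\<close>. This is used for the automorphism and for its
    inverse.\<close>
  have multiple: "\<exists>w. \<rho> [:h:] = smult h w" if "alg_hom h \<rho>" for \<rho>
    using commutator_mod[of h "\<rho> genY" "\<rho> genX"]
    by (simp add: alg_homD[OF that] flip: genY_genX)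
  let ?\<rho> = "inv_into UNIV \<sigma>"
  have b: "bij \<sigma>" and s: "alg_hom h \<sigma>" using assms by (auto simp: is_alg_aut_iff)
  have r: "alg_hom h ?\<rho>" using is_alg_aut_inv[OF assms(1)] by (simp add: is_alg_aut_iff)
  obtain w where w: "\<sigma> [:h:] = smult h w" using multiple[OF s] by blast
  obtain w' where w': "?\<rho> [:h:] = smult h w'" using multiple[OF r] by blast
  \<comment> \<open>Going back and forth gives \<open>h = h w \<sigma>(w')\<close>. Cancelling
    \<open>h\<close> makes \<open>w\<close> a unit, so additivity of degrees puts it first in
    \<open>F[x]\<close> and then among the nonzero scalars.\<close>
  have "[:h:] = \<sigma> (amul h [:h:] w')"
    using w' by (metis amul_const_left b bij_inv_eq_iff)
  also have "\<dots> = smult h (amul h w (\<sigma> w'))"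
    by (simp only: alg_homD[OF s] w amul_smult_left)
  finally have "smult h (amul h w (\<sigma> w') - 1) = 0"
    by (simp add: smult_diff_right one_pCons)
  then have unit: "amul h w (\<sigma> w') = 1"
    using assms(2) by simp
  then have nz: "w \<noteq> 0" "\<sigma> w' \<noteq> 0" by auto
  have "degree w = 0" "degree (\<sigma> w') = 0"
    using degree_amul[OF nz, of h] unit by auto
  then obtain q q' where q: "w = [:q:]" "\<sigma> w' = [:q':]"
    by (metis degree_eq_zeroE)
  then have "q * q' = 1"
    using unit by (simp add: amul_const_const one_pCons)
  then have "q dvd 1" by (metis dvd_triv_left)
  then obtain c where c: "q = [:c:]" "c dvd 1"
    unfolding is_unit_poly_iff by blast
  then have "c \<noteq> 0" by (intro notI) simp
  with c show ?thesis
    using that[of c] w q by simp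
qed

lemma degree_eq_1E:
  assumes "degree p = 1"
  obtains a b where "p = [:a, b:]" "b \<noteq> 0"
proof (cases p)
  case (pCons a q)
  then have "degree q = 0" "q \<noteq> 0" using assms by (auto split: if_splits)
  then obtain b where "q = [:b:]" by (metis degree_eq_zeroE)
  then show ?thesis using that[of a b] pCons \<open>q \<noteq> 0\<close> by simp
qed

lemma alg_aut_genX:
  assumes "is_alg_aut h \<sigma>" "degree h > 0"
  obtains \<alpha> \<beta> where "(\<alpha>, \<beta>) \<in> Pset h" "\<sigma> genX = [:[:\<beta>, \<alpha>:]:]"
proof -
  have s: "alg_hom h \<sigma>" using assms by (simp add: is_alg_aut_iff)
  have "h \<noteq> 0" using assms(2) by auto
  then obtain c where c: "c \<noteq> 0" "\<sigma> [:h:] = [:smult c h:]"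
    using alg_aut_h assms(1) by blast
  \<comment> \<open>Otherwise the image of \<open>h\<close> would have positive degree in
    \<open>yhat\<close>, but it is a scalar multiple of \<open>h\<close>.\<close>
  have "degree (\<sigma> genX) = 0"
    using degree_alg_hom_const[OF s _ \<open>h \<noteq> 0\<close>] c assms(2) by fastforce
  then obtain q where q: "\<sigma> genX = [:q:]" by (metis degree_eq_zeroE)
  then have hq: "pcompose h q = smult c h"
    using alg_hom_const[OF s q, of h] c by simp
  then have "degree h * degree q = degree h"
    using c by (metis degree_pcompose degree_smult_eq)
  then have "degree q = 1" using assms(2) by simp
  then obtain \<beta> \<alpha> where ab: "q = [:\<beta>, \<alpha>:]" "\<alpha> \<noteq> 0"
    by (elim degree_eq_1E)
  \<comment> \<open>Comparing leading coefficients identifies the still unknown scalar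
    \<open>c\<close>.\<close>
  have "lead_coeff (pcompose h q) = lead_coeff h * \<alpha> ^ degree h"
    using \<open>degree q = 1\<close> ab by (subst lead_coeff_comp) auto
  then have "c = \<alpha> ^ degree h"
    using \<open>h \<noteq> 0\<close> c by (simp add: hq mult.commute)
  then show ?thesis using that[of \<alpha> \<beta>] ab hq q by (simp add: Pset_def)
qed

lemma alg_aut_decomp:
  assumes "is_alg_aut h \<sigma>" "degree h > 0"
  obtains f \<alpha> \<beta> where "(\<alpha>, \<beta>) \<in> Pset h" "\<sigma> = phi h f \<circ> tau h \<alpha> \<beta>"
proof -
  have s: "alg_hom h \<sigma>" and b: "bij \<sigma>" using assms by (simp_all add: is_alg_aut_iff)
  obtain \<alpha> \<beta> where P: "(\<alpha>, \<beta>) \<in> Pset h" and X: "\<sigma> genX = [:[:\<beta>, \<alpha>:]:]"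
    using alg_aut_genX[OF assms] by blast
  let ?q = "[:\<beta>, \<alpha>:]"
  have \<alpha>: "\<alpha> \<noteq> 0" using P by (simp add: Pset_def)
  obtain a where a: "\<sigma> a = genY" using b by (metis bij_pointE)
  \<comment> \<open>If \<open>yhat\<close> went into \<open>F[x]\<close>, the whole image would lie
    in \<open>F[x]\<close> and miss \<open>yhat\<close>.\<close>
  have "degree (\<sigma> genY) > 0"
  proof (rule ccontr)
    assume "\<not> degree (\<sigma> genY) > 0"
    then obtain g where g: "\<sigma> genY = [:g:]" by (metis degree_eq_zeroE neq0_conv)
    have "degree (\<sigma> a) = 0" for a
    proof (induction a)
      case 0
      then show ?case by (simp add: alg_homD[OF s])
    next
      case (pCons p a)
      then obtain r where "\<sigma> a = [:r:]" by (metis degree_eq_zeroE)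
      then show ?case
        by (subst alg_hom_pCons[OF s]) (simp add: alg_hom_const[OF s X] g amul_const_const)
    qed
    then have "degree (\<sigma> a) = 0" .
    then show False by (simp add: a genY_def)
  qed
  then have "degree a * degree (\<sigma> genY) = 1"
    using degree_alg_hom[OF s X, of a] a \<alpha> by (cases "a = 0") (auto simp: alg_homD[OF s] genY_def)
  then have "degree (\<sigma> genY) = 1" by simp
  then obtain g f where Y: "\<sigma> genY = [:f, g:]"
    by (elim degree_eq_1E)
  \<comment> \<open>Applying the automorphism to \<open>h = [yhat, x]\<close> yields an equation
    that determines the leading coefficient \<open>g\<close>.\<close>
  have "\<sigma> [:h:] = amul h [:f, g:] [:?q:] - amul h [:?q:] [:f, g:]"
    by (simp only: alg_homD[OF s] X Y flip: genY_genX)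
  also have "\<dots> = [:g * ore_delta h ?q:]"
    by (simp add: amul_pCons left_y_def map_poly_pCons algebra_simps)
  finally have "pcompose h ?q = g * smult \<alpha> h"
    by (simp add: alg_hom_const[OF s X] ore_delta_def pderiv_pCons)
  then have "(g - [:\<alpha> ^ (degree h - 1):]) * smult \<alpha> h = 0"
    using P assms(2) by (simp add: Pset_def algebra_simps flip: power_Suc)
  moreover have "h \<noteq> 0" using assms(2) by auto
  ultimately have g: "g = [:\<alpha> ^ (degree h - 1):]"
    using \<alpha> by simp
  \<comment> \<open>\<open>phi\<close> is applied after \<open>tau\<close> has scaled
    \<open>yhat\<close>, so its summand gets scaled too; dividing by that scalar
    compensates.\<close>
  let ?f = "smult (inverse (\<alpha> ^ (degree h - 1))) f"
  have "\<sigma> = phi h ?f \<circ> tau h \<alpha> \<beta>"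
  proof (rule alg_hom_eqI[OF s])
    show "alg_hom h (phi h ?f \<circ> tau h \<alpha> \<beta>)"
      by (simp add: alg_hom_comp alg_hom_phi alg_hom_tau P assms)
    show "\<sigma> genX = (phi h ?f \<circ> tau h \<alpha> \<beta>) genX"
      by (simp add: X tau_genX phi_const)
    show "\<sigma> genY = (phi h ?f \<circ> tau h \<alpha> \<beta>) genY"
      using \<alpha> by (simp add: Y tau_genY alg_homD(2)[OF alg_hom_phi] phi_genY g) (simp add: genY_def)
  qed
  with P show ?thesis by (rule that)
qed

section \<open>Roots of unity and affine permutations of roots\<close>

definition field_units :: "'a::field monoid" where
  "field_units = \<lparr>carrier = - {0}, mult = (*), one = 1\<rparr>"

lemma field_units_simps [simp]:
  "carrier field_units = - {0}" "x \<otimes>\<^bsub>field_units\<^esub> y = x * y" "\<one>\<^bsub>field_units\<^esub> = 1"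
  by (simp_all add: field_units_def)

lemma group_field_units: "group (field_units :: 'a::field monoid)"
proof (rule groupI)
  show "\<exists>y\<in>carrier field_units. y \<otimes>\<^bsub>field_units\<^esub> x = \<one>\<^bsub>field_units\<^esub>"
    if "x \<in> carrier field_units" for x :: 'a
    using that by (intro bexI[of _ "inverse x"]) auto
qed auto

lemma field_units_pow: "x [^]\<^bsub>field_units\<lparr>carrier := S\<rparr>\<^esub> (n::nat) = x ^ n"
  by (induction n) (simp_all add: nat_pow_def field_units_def)

lemma card_roots_of_unity_le:
  assumes "n > 0"
  shows "finite {x::'a::field. x ^ n = 1}" "card {x::'a::field. x ^ n = 1} \<le> n"
proof -
  let ?p = "monom 1 n - 1 :: 'a poly"
  have deg: "degree ?p = n"
    using assms degree_add_eq_left[of "- 1" "monom 1 n :: 'a poly"] by (simp add: degree_monom_eq)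
  have "{x. x ^ n = 1} = {x. poly ?p x = 0}" by (simp add: poly_monom)
  moreover have "?p \<noteq> 0" using deg assms by auto
  ultimately show "finite {x::'a. x ^ n = 1}" "card {x::'a. x ^ n = 1} \<le> n"
    using poly_roots_finite[of ?p] card_poly_roots_bound[of ?p] deg by simp_all
qed

text \<open>An element \<open>a\<close> of maximal order \<open>m\<close> generates: any \<open>b\<close> whose order does not divide \<open>m\<close> would,
  at a suitable prime, contribute a factor that produces an element of larger order; and
  the \<open>m\<close> powers of \<open>a\<close> already exhaust the roots of \<open>X\<^sup>m - 1\<close>.\<close>

lemma finite_subgroup_field_units_cyclic:
  fixes S :: "'a::field set"
  assumes "finite S" "subgroup S field_units"
  obtains a where "a \<in> S" "S = range (\<lambda>i::nat. a ^ i)"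
proof -
  interpret G: group "field_units\<lparr>carrier := S\<rparr>"
    using assms(2) group_field_units by (rule subgroup.subgroup_is_group)
  let ?G = "field_units\<lparr>carrier := S\<rparr>"
  have fin: "finite (carrier ?G)" using assms by simp
  have pow: "x ^ n = 1 \<longleftrightarrow> G.ord x dvd n" if "x \<in> S" for x n
    using G.pow_eq_id[of x n] that by (simp add: field_units_pow)
  have powS: "x ^ n \<in> S" if "x \<in> S" for x and n :: nat
    using G.nat_pow_closed[of x n] that by (simp add: field_units_pow)
  have multS: "x * y \<in> S" if "x \<in> S" "y \<in> S" for x y
    using G.m_closed[of x y] that by simp
  have pos: "G.ord x > 0" if "x \<in> S" for x
    using G.ord_ge_1[OF fin, of x] that by simp
  have ord_mult: "G.ord x * G.ord y dvd G.ord (x * y)"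
    if xy: "x \<in> S" "y \<in> S" and co: "coprime (G.ord x) (G.ord y)" for x y
  proof -
    have half: "G.ord x dvd G.ord (x * y)"
      if xy: "x \<in> S" "y \<in> S" and co: "coprime (G.ord x) (G.ord y)" for x y
    proof -
      \<comment> \<open>This exponent kills both the product and \<open>y\<close>, hence also
        \<open>x\<close>; coprimality then removes the factor \<open>G.ord y\<close>.\<close>
      let ?k = "G.ord (x * y) * G.ord y"
      have "(x * y) ^ ?k = 1" "y ^ ?k = 1"
        using xy multS by (simp_all add: pow)
      then have "x ^ ?k = 1" by (simp add: power_mult_distrib)
      then show ?thesis
        using xy co by (simp add: pow coprime_dvd_mult_left_iff)
    qed
    show ?thesis
      using half[OF xy co] half[of y x] xy co
      by (intro divides_mult) (simp_all add: coprime_commute mult.commute)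
  qed
  have "G.ord ` S \<noteq> {}" using G.one_closed by auto
  then have "Max (G.ord ` S) \<in> G.ord ` S" using assms(1) by (intro Max_in) auto
  then obtain a where a: "a \<in> S" "G.ord a = Max (G.ord ` S)" by auto
  have max: "G.ord b \<le> G.ord a" if "b \<in> S" for b
    using that assms(1) a by simp
  define m where "m = G.ord a"
  have m: "m > 0" using pos[OF a(1)] by (simp add: m_def)
  have dvd: "G.ord b dvd m" if b: "b \<in> S" for b
  proof (rule multiplicity_le_imp_dvd)
    let ?n = "G.ord b"
    show "?n \<noteq> 0" using pos[OF b] by simp
    show "multiplicity p ?n \<le> multiplicity p m" if p: "prime p" for p
    proof (rule ccontr)
      define e f where "e = multiplicity p ?n" and "f = multiplicity p m"
      assume "\<not> ?thesis"
      then have ef: "f < e" by (simp add: e_def f_def)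
      have pp: "p > 1" using p by (rule prime_gt_1_nat)
      have "p ^ f dvd m" "p ^ e dvd ?n"
        by (simp_all add: e_def f_def multiplicity_dvd)
      then obtain m' n' where m': "m = p ^ f * m'" and n': "?n = p ^ e * n'"
        by (auto elim!: dvdE)
      have pos': "m' > 0" "n' > 0" using m m' pos[OF b] n' by (auto intro: gr0I)
      have "\<not> p dvd m'"
      proof
        assume "p dvd m'"
        then have "p ^ Suc f dvd m" using m' by (auto elim!: dvdE)
        then have "Suc f \<le> multiplicity p m"
          using m pp by (intro multiplicity_geI) auto
        then show False by (simp add: f_def)
      qed
      then have co: "coprime m' (p ^ e)"
        using p by (metis coprime_commute coprime_power_right_iff prime_imp_coprime)
      \<comment> \<open>Removing the \<open>p\<close>-part from \<open>a\<close> and everything but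
        the \<open>p\<close>-part from \<open>b\<close> leaves elements of coprime orders
        \<open>m'\<close> and \<open>p ^ e\<close>. Their product would have order above
        \<open>m\<close>, because \<open>f < e\<close>.\<close>
      let ?c = "a ^ (p ^ f)" and ?d = "b ^ n'"
      have "G.ord ?c = m'"
        using G.ord_pow_gen[of a "p ^ f"] a(1) pp m' by (simp add: field_units_pow flip: m_def)
      moreover have "G.ord ?d = p ^ e"
        using G.ord_pow_gen[of b n'] b pos' n' by (simp add: field_units_pow)
      ultimately have "m' * p ^ e dvd G.ord (?c * ?d)"
        using ord_mult[of ?c ?d] powS a(1) b co by simp
      then have "m' * p ^ e \<le> G.ord (?c * ?d)"
        by (rule dvd_imp_le) (intro pos multS powS a(1) b)
      also have "\<dots> \<le> m"
        unfolding m_def by (intro max multS powS a(1) b)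
      finally have "p ^ e \<le> p ^ f"
        using m' pos' by (simp add: mult.commute)
      then show False using ef pp by simp
    qed
  qed
  let ?A = "(\<lambda>i. a ^ i) ` {0..m - 1}"
  have "inj_on (\<lambda>i. a ^ i) {0..m - 1}"
    using G.ord_inj[of a] a(1) by (simp add: field_units_pow m_def)
  then have "card ?A = m" using m by (simp add: card_image)
  moreover have "?A \<subseteq> {x. x ^ m = 1}"
    using a(1) powS by (auto simp: m_def pow mult.commute simp flip: power_mult)
  ultimately have roots: "?A = {x. x ^ m = 1}"
    using card_roots_of_unity_le[OF m, where 'a = 'a] by (intro card_seteq) auto
  have "S \<subseteq> {x. x ^ m = 1}"
    using dvd by (auto simp: pow)
  then have "S \<subseteq> ?A" by (simp only: roots)
  then have "S \<subseteq> range (\<lambda>i. a ^ i)" by blast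
  then have "S = range (\<lambda>i. a ^ i)" using powS a(1) by auto
  then show ?thesis using that a(1) by blast
qed

text \<open>Compare the product of \<open>z - z\<^sub>0\<close> over \<open>S\<close> without the fixed point \<open>z\<^sub>0\<close> with its reindexing
  under the affine map.\<close>

lemma affine_invariant_set_power:
  fixes S :: "'b::field set"
  assumes "finite S" "a \<noteq> 0" "a \<noteq> 1" and inv: "\<And>z. z \<in> S \<Longrightarrow> a * z + b \<in> S"
  shows "a ^ (card S - 1) = 1 \<or> a ^ card S = 1"
proof -
  define z0 where "z0 = b / (1 - a)"
  define T where "T = S - {z0}"
  \<comment> \<open>In coordinates centred at the fixed point the affine map is multiplication by
    \<open>a\<close>.\<close>
  have "(1 - a) * z0 = b" using assms by (simp add: z0_def)
  then have g: "a * z + b - z0 = a * (z - z0)" for z by (simp add: algebra_simps)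
  have inj: "inj_on (\<lambda>z. a * z + b) T" using assms by (auto simp: inj_on_def)
  have "(\<lambda>z. a * z + b) ` T \<subseteq> T"
  proof clarify
    fix z assume "z \<in> T"
    then show "a * z + b \<in> T"
      using inv[of z] g[of z] assms(2) by (auto simp: T_def)
  qed
  then have im: "(\<lambda>z. a * z + b) ` T = T"
    using inj assms(1) by (intro endo_inj_surj) (auto simp: T_def)
  have "(\<Prod>z\<in>T. z - z0) = (\<Prod>z\<in>(\<lambda>z. a * z + b) ` T. z - z0)" by (simp add: im)
  also have "\<dots> = (\<Prod>z\<in>T. a * (z - z0))"
    by (simp add: prod.reindex[OF inj] g)
  also have "\<dots> = a ^ card T * (\<Prod>z\<in>T. z - z0)"
    by (simp add: prod.distrib)
  finally have "a ^ card T = 1 \<or> (\<Prod>z\<in>T. z - z0) = 0" by auto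
  moreover have "(\<Prod>z\<in>T. z - z0) \<noteq> 0" using assms(1) by (auto simp: T_def)
  \<comment> \<open>The two alternatives for the exponent come from whether the fixed point belongs
    to \<open>S\<close>.\<close>
  moreover have "card T = card S - 1 \<or> card T = card S"
    using assms(1) by (cases "z0 \<in> S") (auto simp: T_def)
  ultimately show ?thesis by auto
qed

section \<open>Evaluation in the algebraic closure and the roots of h\<close>

locale alg_closure_emb =
  fixes emb :: "'a::field \<Rightarrow> 'b::alg_closed_field"
  assumes emb: "is_alg_closure_emb emb"
begin

lemma emb_simps [simp]:
  "emb 0 = 0" "emb 1 = 1" "emb (a + b) = emb a + emb b" "emb (a * b) = emb a * emb b"
  "emb a = emb b \<longleftrightarrow> a = b"
proof -
  show add: "emb (a + b) = emb a + emb b" for a b using emb by (simp add: is_alg_closure_emb_def)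
  show "emb 0 = 0" using add[of 0 0] by (metis add_0 add_right_cancel)
  show "emb a = emb b \<longleftrightarrow> a = b" using emb by (auto simp: is_alg_closure_emb_def inj_def)
qed (use emb in \<open>simp_all add: is_alg_closure_emb_def\<close>)

lemma emb_uminus [simp]: "emb (- a) = - emb a"
  using emb_simps(3)[of "- a" a] by (simp add: eq_neg_iff_add_eq_0 del: emb_simps(3))

lemma emb_diff [simp]: "emb (a - b) = emb a - emb b"
  using emb_simps(3)[of a "- b"] by (simp del: emb_simps(3))

lemma emb_eq_0_iff [simp]: "emb a = 0 \<longleftrightarrow> a = 0"
  using emb_simps(5)[of a 0] by (simp del: emb_simps(5))

lemma emb_eq_1_iff [simp]: "emb a = 1 \<longleftrightarrow> a = 1"
  using emb_simps(5)[of a 1] by (simp del: emb_simps(5))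

lemma emb_power [simp]: "emb (a ^ n) = emb a ^ n"
  by (induction n) simp_all

lemma eval_pCons [simp]:
  "poly (map_poly emb (pCons c p)) z = emb c + z * poly (map_poly emb p) z"
  by (simp add: map_poly_pCons)

lemma eval_add [simp]:
  "poly (map_poly emb (p + q)) z = poly (map_poly emb p) z + poly (map_poly emb q) z"
  by (induction p q rule: poly_induct2) (simp_all add: algebra_simps)

lemma eval_smult [simp]: "poly (map_poly emb (smult c p)) z = emb c * poly (map_poly emb p) z"
  by (induction p) (simp_all add: algebra_simps)

lemma eval_mult [simp]:
  "poly (map_poly emb (p * q)) z = poly (map_poly emb p) z * poly (map_poly emb q) z"
  by (induction p) (simp_all add: algebra_simps)

lemma eval_pcompose:
  "poly (map_poly emb (pcompose p q)) z = poly (map_poly emb p) (poly (map_poly emb q) z)"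
  by (induction p) (simp_all add: pcompose_pCons)

lemma degree_map_emb [simp]: "degree (map_poly emb p) = degree p"
  by (rule degree_map_poly) simp

lemma map_emb_eq_0_iff [simp]: "map_poly emb p = 0 \<longleftrightarrow> p = 0"
  by (rule map_poly_eq_0_iff) simp_all

lemma finite_emb_roots: "p \<noteq> 0 \<Longrightarrow> finite {z. poly (map_poly emb p) z = 0}"
  by (rule poly_roots_finite) simp

lemma Pset_permutes_roots:
  assumes "(\<alpha>, \<beta>) \<in> Pset h" "poly (map_poly emb h) z = 0"
  shows "poly (map_poly emb h) (emb \<alpha> * z + emb \<beta>) = 0"
proof -
  have "poly (map_poly emb (pcompose h [:\<beta>, \<alpha>:])) z = 0"
    using assms by (simp add: Pset_def)
  then show ?thesis by (simp add: eval_pcompose algebra_simps)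
qed

text \<open>A nonconstant \<open>p\<close> has a root in the closure, which must be
  \<open>emb l\<close>, so a linear factor splits off over the base field. Roots of the quotient are
  roots of \<open>p\<close>, so the induction on the degree continues.\<close>

lemma unique_root_imp_linear_power:
  assumes "p \<noteq> 0" "\<And>z. poly (map_poly emb p) z = 0 \<Longrightarrow> z = emb l"
  shows "p = smult (lead_coeff p) ([:- l, 1:] ^ degree p)"
  using assms
proof (induction "degree p" arbitrary: p)
  case 0
  then obtain c where "p = [:c:]" by (metis degree_eq_zeroE)
  then show ?case by simp
next
  case (Suc n)
  obtain z where "poly (map_poly emb p) z = 0"
    using alg_closed_imp_poly_has_root[of "map_poly emb p"] Suc.hyps by auto
  then have "poly (map_poly emb p) (emb l) = 0" using Suc.prems(2) by metis
  moreover have "poly (map_poly emb p) (emb l) = emb (poly p l)" for p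
    by (induction p) simp_all
  ultimately have "poly p l = 0" by simp
  then obtain q where q: "p = [:- l, 1:] * q" by (auto simp: poly_eq_0_iff_dvd elim!: dvdE)
  have q0: "q \<noteq> 0" using Suc.prems q by auto
  have deg: "degree p = Suc (degree q)" using q0 by (simp only: q, subst degree_mult_eq) simp_all
  have "lead_coeff p = lead_coeff q" by (simp only: q lead_coeff_mult) simp
  moreover have "q = smult (lead_coeff q) ([:- l, 1:] ^ degree q)"
    using Suc.hyps deg Suc.prems(2) by (intro Suc.hyps(1) q0) (auto simp only: q eval_mult mult_zero_right)
  ultimately show ?case
    using q deg by (metis mult_smult_right power_Suc)
qed

text \<open>An affine map permuting the roots must fix the only one, which forces \<beta>.
  Conversely, \<open>h\<close> is a scalar times a power of \<open>x - l\<close>, and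
  \<open>x - l\<close> is merely scaled by such a map.\<close>

lemma Pset_unique_root:
  assumes "h \<noteq> 0" and roots: "{z. poly (map_poly emb h) z = 0} = {emb l}"
  shows "Pset h = {(\<alpha>, (1 - \<alpha>) * l) | \<alpha>. \<alpha> \<noteq> 0}"
proof -
  have "(\<alpha>, \<beta>) \<in> Pset h \<longleftrightarrow> \<alpha> \<noteq> 0 \<and> \<beta> = (1 - \<alpha>) * l" for \<alpha> \<beta>
  proof
    assume P: "(\<alpha>, \<beta>) \<in> Pset h"
    have "poly (map_poly emb h) (emb l) = 0" using roots by auto
    then have "emb (\<alpha> * l + \<beta>) = emb l"
      using Pset_permutes_roots[OF P] roots by auto
    then have "\<alpha> * l + \<beta> = l" by (simp only: emb_simps(5))
    then show "\<alpha> \<noteq> 0 \<and> \<beta> = (1 - \<alpha>) * l"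
      using P by (auto simp: Pset_def algebra_simps)
  next
    assume ab: "\<alpha> \<noteq> 0 \<and> \<beta> = (1 - \<alpha>) * l"
    have h: "h = smult (lead_coeff h) ([:- l, 1:] ^ degree h)"
      using assms by (intro unique_root_imp_linear_power) auto
    have lin: "pcompose [:- l, 1:] [:\<beta>, \<alpha>:] = smult \<alpha> [:- l, 1:]"
      using ab by (simp add: pcompose_pCons algebra_simps)
    have "pcompose ([:- l, 1:] ^ n) [:\<beta>, \<alpha>:] = smult (\<alpha> ^ n) ([:- l, 1:] ^ n)" for n
    proof (induction n)
      case 0
      then show ?case by (simp add: pcompose_1)
    next
      case (Suc n)
      then show ?case
        by (simp only: power_Suc pcompose_mult lin mult_smult_left mult_smult_right smult_smult
            mult.commute)
    qed
    then have "pcompose (smult (lead_coeff h) ([:- l, 1:] ^ degree h)) [:\<beta>, \<alpha>:] =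
        smult (\<alpha> ^ degree h) (smult (lead_coeff h) ([:- l, 1:] ^ degree h))"
      by (simp add: pcompose_smult mult.commute)
    then have "pcompose h [:\<beta>, \<alpha>:] = smult (\<alpha> ^ degree h) h"
      by (simp only: h[symmetric])
    then show "(\<alpha>, \<beta>) \<in> Pset h" using ab by (simp add: Pset_def)
  qed
  then show ?thesis by auto
qed

text \<open>A nontrivial scaling with coefficients in the base field has its fixed point
  \<open>\<beta> / (1 - \<alpha>)\<close> there, whereas the fixed root lies outside.\<close>

lemma Pset_unique_root_not_in_field:
  assumes roots: "{z. poly (map_poly emb h) z = 0} = {lam}" and lam: "lam \<notin> range emb"
  shows "Pset h = {(1, 0)}"
proof -
  have "\<alpha> = 1 \<and> \<beta> = 0" if P: "(\<alpha>, \<beta>) \<in> Pset h" for \<alpha> \<beta>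
  proof -
    have "poly (map_poly emb h) lam = 0" using roots by auto
    then have "emb \<alpha> * lam + emb \<beta> = lam"
      using Pset_permutes_roots[OF P] roots by auto
    then have eq: "emb \<beta> = emb (1 - \<alpha>) * lam" by (simp add: algebra_simps)
    have "\<alpha> = 1"
    proof (rule ccontr)
      assume "\<alpha> \<noteq> 1"
      then have "emb (1 - \<alpha>) * emb (\<beta> / (1 - \<alpha>)) = emb \<beta>"
        by (simp del: emb_diff flip: emb_simps(4))
      with eq have "emb (1 - \<alpha>) * emb (\<beta> / (1 - \<alpha>)) = emb (1 - \<alpha>) * lam" by metis
      then have "emb (\<beta> / (1 - \<alpha>)) = lam" using \<open>\<alpha> \<noteq> 1\<close> by simp
      then show False using lam by blast
    qed
    with eq show ?thesis by simp
  qed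
  then show ?thesis using Pset_1_0 by auto
qed

text \<open>An affine map is determined by its values at two distinct points. At two roots these
  values are again roots, which leaves finitely many choices.\<close>

lemma finite_Pset:
  assumes "h \<noteq> 0" "card {z. poly (map_poly emb h) z = 0} \<ge> 2"
  shows "finite (Pset h)"
proof -
  let ?R = "{z. poly (map_poly emb h) z = 0}"
  have fin: "finite ?R" by (rule finite_emb_roots) fact
  obtain x y where xy: "x \<in> ?R" "y \<in> ?R" "x \<noteq> y"
    using assms(2) by (meson card_2_iff' obtain_subset_with_card_n subset_iff)
  let ?g = "\<lambda>(\<alpha>, \<beta>). (emb \<alpha> * x + emb \<beta>, emb \<alpha> * y + emb \<beta>)"
  have "inj_on ?g (Pset h)"
  proof (rule inj_onI, clarsimp)
    fix \<alpha> \<beta> \<alpha>' \<beta>'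
    assume 1: "emb \<alpha> * x + emb \<beta> = emb \<alpha>' * x + emb \<beta>'"
      and 2: "emb \<alpha> * y + emb \<beta> = emb \<alpha>' * y + emb \<beta>'"
    have "(emb \<alpha> - emb \<alpha>') * (x - y) = (emb \<alpha> * x + emb \<beta>) - (emb \<alpha> * y + emb \<beta>)
        - (emb \<alpha>' * x + emb \<beta>') + (emb \<alpha>' * y + emb \<beta>')"
      by (simp add: algebra_simps)
    also have "\<dots> = 0" unfolding 1 2 by simp
    finally show "\<alpha> = \<alpha>' \<and> \<beta> = \<beta>'" using xy 1 by auto
  qed
  moreover have "?g ` Pset h \<subseteq> ?R \<times> ?R"
    using xy Pset_permutes_roots by auto
  ultimately show ?thesis
    using fin by (meson finite_SigmaI finite_imageD finite_subset)
qed

lemma Pset_power_card_roots: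
  assumes "h \<noteq> 0" "(\<alpha>, \<beta>) \<in> Pset h" "\<alpha> \<noteq> 1" "k = card {z. poly (map_poly emb h) z = 0}"
  shows "\<alpha> ^ (k - 1) = 1 \<or> \<alpha> ^ k = 1"
proof -
  have "emb \<alpha> ^ (k - 1) = 1 \<or> emb \<alpha> ^ k = 1"
    unfolding assms(4) using assms Pset_permutes_roots[OF assms(2)]
    by (intro affine_invariant_set_power[of _ _ "emb \<beta>"] finite_emb_roots) (auto simp: Pset_def)
  then show ?thesis by (simp flip: emb_power)
qed

end

section \<open>The automorphism group\<close>

text \<open>A splitting criterion behind every semidirect product below: a subgroup mapped
  injectively and onto the image is a complement of the kernel, as
  \<open>x = (x y\<^sup>-\<^sup>1) y\<close> for \<open>y\<close> in \<open>K\<close> with the same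
  image.\<close>

lemma (in group_hom) is_semidirect_kernel:
  assumes K: "subgroup K G" and onto: "h ` carrier G \<subseteq> h ` K"
    and triv: "\<And>x. x \<in> K \<Longrightarrow> h x = \<one>\<^bsub>H\<^esub> \<Longrightarrow> x = \<one>"
  shows "is_semidirect G (kernel G H h) K"
proof -
  have KG: "x \<in> carrier G" if "x \<in> K" for x
    using subgroup.subset[OF K] that by blast
  have "x \<in> kernel G H h <#> K" if x: "x \<in> carrier G" for x
  proof -
    obtain y where y: "y \<in> K" "h x = h y" using onto x by auto
    have "h (x \<otimes> inv y) = \<one>\<^bsub>H\<^esub>"
      using x y KG by simp
    then have "x \<otimes> inv y \<in> kernel G H h"
      using x y KG by (simp add: kernel_def)
    moreover have "x = (x \<otimes> inv y) \<otimes> y"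
      using x y KG by (simp add: G.m_assoc)
    ultimately show ?thesis
      using y(1) unfolding set_mult_def by blast
  qed
  moreover have "kernel G H h <#> K \<subseteq> carrier G"
    using KG by (auto simp: set_mult_def kernel_def)
  moreover have "kernel G H h \<inter> K = {\<one>}"
  proof (intro equalityI subsetI)
    show "x \<in> {\<one>}" if "x \<in> kernel G H h \<inter> K" for x
      using triv that unfolding kernel_def by blast
    show "x \<in> kernel G H h \<inter> K" if "x \<in> {\<one>}" for x
      using that subgroup.one_closed[OF K] by (simp add: kernel_def)
  qed
  ultimately show ?thesis
    unfolding is_semidirect_def using normal_kernel K by auto
qed

lemma AutG_simps [simp]:
  "carrier (AutG h) = {\<sigma>. is_alg_aut h \<sigma>}" "\<sigma> \<otimes>\<^bsub>AutG h\<^esub> \<rho> = \<sigma> \<circ> \<rho>" "\<one>\<^bsub>AutG h\<^esub> = id"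
  by (simp_all add: AutG_def)

lemma group_AutG: "group (AutG h)"
proof (rule groupI)
  show "\<exists>\<rho>\<in>carrier (AutG h). \<rho> \<otimes>\<^bsub>AutG h\<^esub> \<sigma> = \<one>\<^bsub>AutG h\<^esub>" if "\<sigma> \<in> carrier (AutG h)" for \<sigma>
    using that is_alg_aut_inv[of h \<sigma>]
    by (intro bexI[of _ "inv_into UNIV \<sigma>"]) (auto simp: is_alg_aut_iff bij_is_inj)
  show "\<one>\<^bsub>AutG h\<^esub> \<in> carrier (AutG h)"
    by (simp add: is_alg_aut_iff alg_hom_id)
qed (auto simp: is_alg_aut_comp comp_assoc)

text \<open>For an automorphism this is the \<alpha> in its decomposition. Reading it off the image
  of \<open>x\<close> gives a total function without choosing a decomposition.\<close>

definition x_scale :: "('a::field poly poly \<Rightarrow> 'a poly poly) \<Rightarrow> 'a" where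
  "x_scale \<sigma> = coeff (coeff (\<sigma> genX) 0) 1"

definition x_shift :: "('a::field poly poly \<Rightarrow> 'a poly poly) \<Rightarrow> 'a" where
  "x_shift \<sigma> = coeff (coeff (\<sigma> genX) 0) 0"

definition affine_part :: "'a::field poly \<Rightarrow> ('a poly poly \<Rightarrow> 'a poly poly) \<Rightarrow> 'a poly poly \<Rightarrow> 'a poly poly" where
  "affine_part h \<sigma> = tau h (x_scale \<sigma>) (x_shift \<sigma>)"

lemma x_scale_phi_tau [simp]: "x_scale (phi h f \<circ> tau h \<alpha> \<beta>) = \<alpha>"
  and x_shift_phi_tau [simp]: "x_shift (phi h f \<circ> tau h \<alpha> \<beta>) = \<beta>"
  by (simp_all add: x_scale_def x_shift_def tau_genX phi_const)

lemma x_scale_tau [simp]: "x_scale (tau h \<alpha> \<beta>) = \<alpha>"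
  and x_shift_tau [simp]: "x_shift (tau h \<alpha> \<beta>) = \<beta>"
  by (simp_all add: x_scale_def x_shift_def tau_genX)

lemma x_scale_id [simp]: "x_scale id = 1"
  and x_shift_id [simp]: "x_shift id = 0"
  by (simp_all add: x_scale_def x_shift_def genX_def)

lemma affine_part_phi_tau [simp]: "affine_part h (phi h f \<circ> tau h \<alpha> \<beta>) = tau h \<alpha> \<beta>"
  unfolding affine_part_def by simp

lemma affine_part_tau [simp]: "affine_part h (tau h \<alpha> \<beta>) = tau h \<alpha> \<beta>"
  unfolding affine_part_def by simp

lemma affine_part_phi [simp]: "affine_part h (phi h f) = id"
  using affine_part_phi_tau[of h f 1 0] by (simp only: tau_1_0 comp_id)

locale ore_algebra =
  fixes h :: "'a::field poly"
  assumes degree_pos: "degree h > 0"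
begin

text \<open>Moving \<open>tau\<close> past \<open>phi\<close> changes only the polynomial in
  \<open>phi\<close>, so the affine data multiply by themselves; this makes \<open>x_scale\<close>
  and \<open>affine_part\<close> homomorphisms.\<close>

lemma phi_tau_comp:
  assumes "(\<alpha>, \<beta>) \<in> Pset h" "(\<alpha>', \<beta>') \<in> Pset h"
  shows "\<exists>g. (phi h f \<circ> tau h \<alpha> \<beta>) \<circ> (phi h f' \<circ> tau h \<alpha>' \<beta>') =
    phi h g \<circ> tau h (\<alpha> * \<alpha>') (\<alpha>' * \<beta> + \<beta>')"
proof -
  obtain g where g: "tau h \<alpha> \<beta> \<circ> phi h f' = phi h g \<circ> tau h \<alpha> \<beta>"
    using tau_comp_phi[OF assms(1) degree_pos] by blast
  have "(phi h f \<circ> tau h \<alpha> \<beta>) \<circ> (phi h f' \<circ> tau h \<alpha>' \<beta>')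
      = phi h f \<circ> (tau h \<alpha> \<beta> \<circ> phi h f') \<circ> tau h \<alpha>' \<beta>'"
    by (simp only: comp_assoc)
  also have "\<dots> = (phi h f \<circ> phi h g) \<circ> (tau h \<alpha> \<beta> \<circ> tau h \<alpha>' \<beta>')"
    by (simp only: g comp_assoc)
  also have "\<dots> = phi h (f + g) \<circ> tau h (\<alpha> * \<alpha>') (\<alpha>' * \<beta> + \<beta>')"
    by (simp only: phi_comp_phi tau_comp_tau[OF assms degree_pos])
  finally show ?thesis by blast
qed

lemma aut_cases:
  assumes "is_alg_aut h \<sigma>"
  obtains f \<alpha> \<beta> where "(\<alpha>, \<beta>) \<in> Pset h" "\<sigma> = phi h f \<circ> tau h \<alpha> \<beta>"
  using alg_aut_decomp[OF assms degree_pos] by blast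

lemma aut_tau: "(\<alpha>, \<beta>) \<in> Pset h \<Longrightarrow> is_alg_aut h (tau h \<alpha> \<beta>)"
  by (rule is_alg_aut_tau[OF _ degree_pos])

lemma comp_affine:
  assumes "is_alg_aut h \<sigma>" "is_alg_aut h \<rho>"
  shows "x_scale (\<sigma> \<circ> \<rho>) = x_scale \<sigma> * x_scale \<rho>"
    and "x_shift (\<sigma> \<circ> \<rho>) = x_scale \<rho> * x_shift \<sigma> + x_shift \<rho>"
    and "affine_part h (\<sigma> \<circ> \<rho>) = affine_part h \<sigma> \<circ> affine_part h \<rho>"
proof -
  obtain f \<alpha> \<beta> where s: "(\<alpha>, \<beta>) \<in> Pset h" "\<sigma> = phi h f \<circ> tau h \<alpha> \<beta>"
    using aut_cases[OF assms(1)] by blast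
  obtain f' \<alpha>' \<beta>' where r: "(\<alpha>', \<beta>') \<in> Pset h" "\<rho> = phi h f' \<circ> tau h \<alpha>' \<beta>'"
    using aut_cases[OF assms(2)] by blast
  obtain g where g: "\<sigma> \<circ> \<rho> = phi h g \<circ> tau h (\<alpha> * \<alpha>') (\<alpha>' * \<beta> + \<beta>')"
    using phi_tau_comp[OF s(1) r(1)] s r by blast
  show "x_scale (\<sigma> \<circ> \<rho>) = x_scale \<sigma> * x_scale \<rho>"
    "x_shift (\<sigma> \<circ> \<rho>) = x_scale \<rho> * x_shift \<sigma> + x_shift \<rho>"
    "affine_part h (\<sigma> \<circ> \<rho>) = affine_part h \<sigma> \<circ> affine_part h \<rho>"
    unfolding g unfolding s r x_scale_phi_tau x_shift_phi_tau affine_part_phi_tau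
    by (simp_all add: tau_comp_tau[OF s(1) r(1) degree_pos])
qed

sublocale Aut: group "AutG h"
  by (rule group_AutG)

sublocale affine: group_hom "AutG h" "AutG h" "affine_part h"
proof (unfold_locales, rule homI)
  show "affine_part h \<sigma> \<in> carrier (AutG h)" if "\<sigma> \<in> carrier (AutG h)" for \<sigma>
    using that by (auto elim!: aut_cases intro: aut_tau simp del: o_apply)
qed (simp add: comp_affine)

sublocale scale: group_hom "AutG h" field_units x_scale
proof -
  interpret group "field_units :: 'a monoid" by (rule group_field_units)
  show "group_hom (AutG h) field_units x_scale"
  proof (unfold_locales, rule homI)
    show "x_scale \<sigma> \<in> carrier field_units" if "\<sigma> \<in> carrier (AutG h)" for \<sigma>
      using that by (auto elim!: aut_cases simp: Pset_def simp del: o_apply)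
  qed (simp add: comp_affine)
qed

text \<open>Shows that \<open>affine_part\<close> is a retraction of the automorphism group onto
  \<open>tauP h\<close>, which makes \<open>tauP h\<close> a complement of the kernel.\<close>

lemma tauP_iff: "\<sigma> \<in> tauP h \<longleftrightarrow> is_alg_aut h \<sigma> \<and> affine_part h \<sigma> = \<sigma>"
proof
  show "is_alg_aut h \<sigma> \<and> affine_part h \<sigma> = \<sigma>" if "\<sigma> \<in> tauP h"
    using that by (auto simp: tauP_def aut_tau)
  show "\<sigma> \<in> tauP h" if *: "is_alg_aut h \<sigma> \<and> affine_part h \<sigma> = \<sigma>"
  proof -
    obtain f \<alpha> \<beta> where s: "(\<alpha>, \<beta>) \<in> Pset h" "\<sigma> = phi h f \<circ> tau h \<alpha> \<beta>"
      using aut_cases * by blast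
    then have "\<sigma> = tau h \<alpha> \<beta>" using * by (metis affine_part_phi_tau)
    then show ?thesis using s by (auto simp: tauP_def)
  qed
qed

lemma affine_part_image: "affine_part h ` {\<sigma>. is_alg_aut h \<sigma>} = tauP h"
proof
  show "affine_part h ` {\<sigma>. is_alg_aut h \<sigma>} \<subseteq> tauP h"
    by (auto elim!: aut_cases simp: tauP_def simp del: o_apply)
  show "tauP h \<subseteq> affine_part h ` {\<sigma>. is_alg_aut h \<sigma>}"
    by (auto simp: tauP_iff image_iff) metis
qed

lemma subgroup_tauP: "subgroup (tauP h) (AutG h)"
  using affine.img_is_subgroup by (simp add: affine_part_image)

lemma kernel_affine: "kernel (AutG h) (AutG h) (affine_part h) = phiset h"
proof
  show "kernel (AutG h) (AutG h) (affine_part h) \<subseteq> phiset h"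
  proof
    fix \<sigma> assume "\<sigma> \<in> kernel (AutG h) (AutG h) (affine_part h)"
    then have *: "is_alg_aut h \<sigma>" "affine_part h \<sigma> = id" by (auto simp: kernel_def)
    then obtain f \<alpha> \<beta> where "\<sigma> = phi h f \<circ> tau h \<alpha> \<beta>" using aut_cases by blast
    then show "\<sigma> \<in> phiset h" using * by (auto simp: phiset_def)
  qed
  show "phiset h \<subseteq> kernel (AutG h) (AutG h) (affine_part h)"
    by (auto simp: kernel_def phiset_def is_alg_aut_phi)
qed

lemma semidirect_phi_tauP: "is_semidirect (AutG h) (phiset h) (tauP h)"
proof -
  have "is_semidirect (AutG h) (kernel (AutG h) (AutG h) (affine_part h)) (tauP h)"
  proof (rule affine.is_semidirect_kernel[OF subgroup_tauP])
    show "affine_part h ` carrier (AutG h) \<subseteq> affine_part h ` tauP h"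
      using affine_part_image by (auto simp: tauP_iff image_iff)
  qed (simp add: tauP_iff)
  then show ?thesis by (simp only: kernel_affine)
qed

abbreviation TauP :: "('a poly poly \<Rightarrow> 'a poly poly) monoid" where
  "TauP \<equiv> (AutG h)\<lparr>carrier := tauP h\<rparr>"

sublocale tau_scale: group_hom TauP field_units x_scale
  by (rule scale.induced_group_hom'[OF subgroup_tauP])

lemma kernel_tau_scale: "kernel TauP field_units x_scale = tau1G h"
  by (auto simp: kernel_def tauP_def tau1G_def Gset_def)

lemma subgroup_tau1G: "subgroup (tau1G h) (AutG h)"
  using tau_scale.subgroup_kernel subgroup_tauP
  unfolding kernel_tau_scale by (metis Aut.incl_subgroup)

abbreviation PhiTau1 :: "('a poly poly \<Rightarrow> 'a poly poly) set" where
  "PhiTau1 \<equiv> phiset h <#>\<^bsub>AutG h\<^esub> tau1G h"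

text \<open>Exhibiting the product of \<open>phiset h\<close> and \<open>tau1G h\<close> as a kernel
  yields its normality in the full automorphism group.\<close>

lemma kernel_scale: "kernel (AutG h) field_units x_scale = PhiTau1"
proof
  show "kernel (AutG h) field_units x_scale \<subseteq> PhiTau1"
  proof
    fix \<sigma> assume "\<sigma> \<in> kernel (AutG h) field_units x_scale"
    then have *: "is_alg_aut h \<sigma>" "x_scale \<sigma> = 1" by (auto simp: kernel_def)
    then obtain f \<alpha> \<beta> where s: "(\<alpha>, \<beta>) \<in> Pset h" "\<sigma> = phi h f \<circ> tau h \<alpha> \<beta>"
      using aut_cases by blast
    then have "\<alpha> = 1" using * by (simp del: o_apply)
    then show "\<sigma> \<in> PhiTau1"
      using s by (auto simp: set_mult_def phiset_def tau1G_def Gset_def)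
  qed
  show "PhiTau1 \<subseteq> kernel (AutG h) field_units x_scale"
    by (auto simp: set_mult_def phiset_def tau1G_def Gset_def kernel_def aut_tau
        is_alg_aut_comp is_alg_aut_phi simp del: o_apply)
qed

lemma normal_PhiTau1: "PhiTau1 \<lhd> AutG h"
  using scale.normal_kernel by (simp only: kernel_scale)

lemma semidirect_PhiTau1: "is_semidirect ((AutG h)\<lparr>carrier := PhiTau1\<rparr>) (phiset h) (tau1G h)"
proof -
  have sub: "subgroup PhiTau1 (AutG h)"
    using normal_PhiTau1 by (rule normal_imp_subgroup)
  \<comment> \<open>The affine projection is restricted to this subgroup; its kernel stays
    \<open>phiset h\<close>, since every \<open>phi\<close> lies in the subgroup.\<close>
  interpret N: group_hom "(AutG h)\<lparr>carrier := PhiTau1\<rparr>" "AutG h" "affine_part h"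
    by (rule affine.induced_group_hom'[OF sub])
  have phi: "phiset h \<subseteq> PhiTau1"
  proof
    fix \<sigma> assume "\<sigma> \<in> phiset h"
    moreover have "id \<in> tau1G h" using subgroup.one_closed[OF subgroup_tau1G] by simp
    moreover have "\<sigma> = \<sigma> \<otimes>\<^bsub>AutG h\<^esub> id" by simp
    ultimately show "\<sigma> \<in> PhiTau1" unfolding set_mult_def by blast
  qed
  have tau1: "tau1G h \<subseteq> PhiTau1"
    unfolding kernel_scale[symmetric] by (auto simp: tau1G_def Gset_def kernel_def aut_tau)
  have ker: "kernel ((AutG h)\<lparr>carrier := PhiTau1\<rparr>) (AutG h) (affine_part h) = phiset h"
    using phi subgroup.subset[OF sub] by (auto simp: kernel_def simp flip: kernel_affine)
  have "is_semidirect ((AutG h)\<lparr>carrier := PhiTau1\<rparr>)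
      (kernel ((AutG h)\<lparr>carrier := PhiTau1\<rparr>) (AutG h) (affine_part h)) (tau1G h)"
  proof (rule N.is_semidirect_kernel)
    show "subgroup (tau1G h) ((AutG h)\<lparr>carrier := PhiTau1\<rparr>)"
      by (rule Aut.subgroup_incl[OF subgroup_tau1G sub tau1])
    show "affine_part h ` carrier ((AutG h)\<lparr>carrier := PhiTau1\<rparr>) \<subseteq> affine_part h ` tau1G h"
      by (auto simp: set_mult_def phiset_def tau1G_def image_iff simp del: o_apply)
  qed (auto simp: tau1G_def)
  then show ?thesis by (simp only: ker)
qed

text \<open>By the first isomorphism theorem for \<open>x_scale\<close>, the quotient is isomorphic
  to the group of scales, a finite and hence cyclic subgroup of the units of the field. The last
  claim takes a generator of that group.\<close>

lemma cyclic_quotient: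
  assumes fin: "finite (Pset h)"
  shows "finite (carrier (TauP Mod tau1G h))" "cyclic_group (TauP Mod tau1G h)"
    and "tauP h \<noteq> tau1G h \<Longrightarrow> \<exists>\<alpha> \<beta>. (\<alpha>, \<beta>) \<in> Pset h \<and> \<alpha> \<noteq> 1
      \<and> x_scale ` tauP h = range (\<lambda>i::nat. \<alpha> ^ i)"
proof -
  have finT: "finite (tauP h)" using fin by (simp add: tauP_def)
  then show "finite (carrier (TauP Mod tau1G h))"
    by (simp add: FactGroup_def RCOSETS_def)
  let ?S = "x_scale ` tauP h"
  have S: "subgroup ?S field_units"
    using tau_scale.img_is_subgroup by simp
  obtain a where a: "a \<in> ?S" "?S = range (\<lambda>i::nat. a ^ i)"
    using finite_subgroup_field_units_cyclic[OF _ S] finT by blast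
  interpret S: group "field_units\<lparr>carrier := ?S\<rparr>"
    using S group_field_units by (rule subgroup.subgroup_is_group)
  interpret f: group_hom TauP "field_units\<lparr>carrier := ?S\<rparr>" x_scale
    using tau_scale.homh by unfold_locales (auto simp: hom_def)
  have "kernel TauP (field_units\<lparr>carrier := ?S\<rparr>) x_scale = tau1G h"
    using kernel_tau_scale by (simp add: kernel_def)
  then have iso: "TauP Mod tau1G h \<cong> field_units\<lparr>carrier := ?S\<rparr>"
    using f.FactGroup_iso by simp
  have "group (TauP Mod tau1G h)"
    using normal.factorgroup_is_group[OF tau_scale.normal_kernel] by (simp only: kernel_tau_scale)
  moreover have "cyclic_group (field_units\<lparr>carrier := ?S\<rparr>)"
    unfolding S.cyclic_group
  proof (intro bexI[of _ a] equalityI subsetI)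
    fix s assume "s \<in> carrier (field_units\<lparr>carrier := ?S\<rparr>)"
    then obtain i :: nat where "s = a ^ i" using a(2) by auto
    then have "s = a [^]\<^bsub>field_units\<lparr>carrier := ?S\<rparr>\<^esub> int i"
      by (simp add: int_pow_int field_units_pow)
    then show "s \<in> range (\<lambda>n::int. a [^]\<^bsub>field_units\<lparr>carrier := ?S\<rparr>\<^esub> n)" by blast
  next
    fix s assume "s \<in> range (\<lambda>n::int. a [^]\<^bsub>field_units\<lparr>carrier := ?S\<rparr>\<^esub> n)"
    then show "s \<in> carrier (field_units\<lparr>carrier := ?S\<rparr>)"
      using S.int_pow_closed a(1) by auto
  qed (use a in simp)
  ultimately show "cyclic_group (TauP Mod tau1G h)"
    using isomorphic_group_cyclicity[OF iso] S.is_group by blast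
  show "\<exists>\<alpha> \<beta>. (\<alpha>, \<beta>) \<in> Pset h \<and> \<alpha> \<noteq> 1 \<and> ?S = range (\<lambda>i::nat. \<alpha> ^ i)"
    if ne: "tauP h \<noteq> tau1G h"
  proof -
    obtain \<beta> where "(a, \<beta>) \<in> Pset h" using a(1) by (auto simp: tauP_def)
    moreover have "a \<noteq> 1"
    proof
      \<comment> \<open>With a trivial generator all scales are 1, so \<open>tauP h\<close> would
        equal the kernel \<open>tau1G h\<close>.\<close>
      assume "a = 1"
      then have "x_scale \<tau> = 1" if "\<tau> \<in> tauP h" for \<tau> using a(2) that by auto
      then show False using ne by (auto simp: kernel_def simp flip: kernel_tau_scale)
    qed
    ultimately show ?thesis using a(2) by blast
  qed
qed

text \<open>All elements of the subgroup generated by \<open>\<tau>\<^sub>\<alpha>\<^sub>,\<^sub>\<beta>\<close> fix the point \<open>\<beta> / (1 - \<alpha>)\<close>, so the only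
  translation among them is the identity.\<close>

lemma generate_tau_fixed_point:
  assumes P: "(\<alpha>, \<beta>) \<in> Pset h" and ne: "\<alpha> \<noteq> 1"
    and x: "\<sigma> \<in> generate (AutG h) {tau h \<alpha> \<beta>}"
  shows "\<sigma> \<in> tauP h \<and> x_shift \<sigma> = (1 - x_scale \<sigma>) * (\<beta> / (1 - \<alpha>))"
  using x
proof induction
  case one
  then show ?case
    using subgroup.one_closed[OF subgroup_tauP]
    by (simp only: AutG_simps x_scale_id x_shift_id) simp
next
  case (incl \<sigma>)
  then show ?case using P ne by (auto simp: tauP_def)
next
  case (inv \<sigma>)
  have \<alpha>: "\<alpha> \<noteq> 0" using P by (simp add: Pset_def)
  have "inv\<^bsub>AutG h\<^esub> (tau h \<alpha> \<beta>) = tau h (inverse \<alpha>) (- (\<beta> * inverse \<alpha>))"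
    using P Pset_inverse[OF P] tau_inverse[OF P degree_pos]
    by (intro Aut.inv_equality) (simp_all add: aut_tau)
  moreover have "- (\<beta> * inverse \<alpha>) = (1 - inverse \<alpha>) * (\<beta> / (1 - \<alpha>))"
    using \<alpha> ne by (simp add: field_simps)
  ultimately show ?case using inv Pset_inverse[OF P] by (force simp: tauP_def)
next
  case (eng \<sigma> \<rho>)
  have "\<sigma> \<circ> \<rho> \<in> tauP h"
    using subgroup.m_closed[OF subgroup_tauP] eng by simp
  \<comment> \<open>The equation says that the affine map fixes \<open>c\<close>, a property
    inherited by compositions.\<close>
  moreover have "x_shift (\<sigma> \<circ> \<rho>) = (1 - x_scale (\<sigma> \<circ> \<rho>)) * c"
    if "x_shift \<sigma> = (1 - x_scale \<sigma>) * c" "x_shift \<rho> = (1 - x_scale \<rho>) * c" for c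
  proof -
    have "is_alg_aut h \<sigma>" "is_alg_aut h \<rho>" using eng by (simp_all add: tauP_iff)
    from comp_affine(1,2)[OF this] show ?thesis
      by (simp only: that) (simp add: algebra_simps)
  qed
  ultimately show ?case using eng unfolding AutG_simps by blast
qed

text \<open>On the cyclic subgroup \<open>x_scale\<close> is injective because of the common fixed
  point, and it reaches every scale because \<alpha> generates them. The splitting criterion then
  applies inside \<open>tauP h\<close> and inside the whole group.\<close>

lemma semidirect_generate_tau:
  assumes P: "(\<alpha>, \<beta>) \<in> Pset h" and ne: "\<alpha> \<noteq> 1"
    and S: "x_scale ` tauP h = range (\<lambda>i::nat. \<alpha> ^ i)"
  shows "is_semidirect TauP (tau1G h) (generate (AutG h) {tau h \<alpha> \<beta>})"
    and "is_semidirect (AutG h) PhiTau1 (generate (AutG h) {tau h \<alpha> \<beta>})"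
proof -
  let ?\<gamma> = "tau h \<alpha> \<beta>" and ?H = "generate (AutG h) {tau h \<alpha> \<beta>}"
  have \<gamma>: "?\<gamma> \<in> carrier (AutG h)" using P by (simp add: aut_tau)
  have H: "subgroup ?H (AutG h)"
    using \<gamma> by (intro Aut.generate_is_subgroup) simp
  have HT: "?H \<subseteq> tauP h"
    using generate_tau_fixed_point[OF P ne] by blast
  have triv: "\<sigma> = id" if "\<sigma> \<in> ?H" "x_scale \<sigma> = 1" for \<sigma>
  proof -
    have "\<sigma> \<in> tauP h" "x_shift \<sigma> = 0"
      using generate_tau_fixed_point[OF P ne that(1)] that(2) by auto
    then show ?thesis using that(2) by (metis affine_part_def tauP_iff tau_1_0)
  qed
  have SH: "x_scale ` tauP h \<subseteq> x_scale ` ?H"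
  proof -
    have "\<alpha> ^ i \<in> x_scale ` ?H" for i
    proof (induction i)
      case 0
      then show ?case using subgroup.one_closed[OF H] by (force simp: image_iff)
    next
      case (Suc i)
      then obtain \<sigma> where \<sigma>: "\<sigma> \<in> ?H" "x_scale \<sigma> = \<alpha> ^ i" by auto
      have "?\<gamma> \<circ> \<sigma> \<in> ?H"
        using subgroup.m_closed[OF H _ \<sigma>(1), of ?\<gamma>] by (simp add: generate.incl)
      moreover have "x_scale (?\<gamma> \<circ> \<sigma>) = \<alpha> ^ Suc i"
        using \<gamma> \<sigma> subgroup.subset[OF H] by (subst comp_affine) auto
      ultimately show ?case by (metis imageI)
    qed
    then show ?thesis using S by auto
  qed
  have "is_semidirect TauP (kernel TauP field_units x_scale) ?H"
    using SH triv by (intro tau_scale.is_semidirect_kernel Aut.subgroup_incl[OF H subgroup_tauP HT]) auto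
  then show "is_semidirect TauP (tau1G h) ?H" by (simp only: kernel_tau_scale)
  \<comment> \<open>An automorphism has the same scale as its \<open>tau\<close> factor, so the full
    group contributes no new scales.\<close>
  have "x_scale ` carrier (AutG h) \<subseteq> x_scale ` tauP h"
    by (auto elim!: aut_cases simp: tauP_def image_iff simp del: o_apply) force
  then have "is_semidirect (AutG h) (kernel (AutG h) field_units x_scale) ?H"
    using SH triv by (intro scale.is_semidirect_kernel H) auto
  then show "is_semidirect (AutG h) PhiTau1 ?H" by (simp only: kernel_scale)
qed

lemma conj_phi:
  assumes P: "(\<alpha>, \<beta>) \<in> Pset h"
  shows "inv_into UNIV (tau h \<alpha> \<beta>) \<circ> phi h f \<circ> tau h \<alpha> \<beta> =
    phi h (smult (\<alpha> ^ (degree h - 1)) (pcompose f [:- (\<beta> * inverse \<alpha>), inverse \<alpha>:]))"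
proof -
  have "inv_into UNIV (tau h \<alpha> \<beta>) \<circ> tau h \<alpha> \<beta> = id"
    using bij_tau[OF P degree_pos] by (simp add: bij_is_inj)
  then show ?thesis
    by (simp only: comp_assoc phi_comp_tau[OF P degree_pos]) (simp only: id_comp flip: comp_assoc)
qed

lemma conj_tau1:
  assumes P: "(\<alpha>, \<beta>) \<in> Pset h" and \<nu>: "\<nu> \<in> Gset h"
  shows "inv_into UNIV (tau h \<alpha> \<beta>) \<circ> tau h 1 \<nu> \<circ> tau h \<alpha> \<beta> = tau h 1 (\<alpha> * \<nu>)"
proof -
  have \<nu>': "(1, \<nu>) \<in> Pset h" using \<nu> by (simp add: Gset_def)
  have \<alpha>: "\<alpha> \<noteq> 0" using P by (simp add: Pset_def)
  have "inv_into UNIV (tau h \<alpha> \<beta>) \<circ> (tau h 1 \<nu> \<circ> tau h \<alpha> \<beta>) =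
      tau h (inverse \<alpha>) (- (\<beta> * inverse \<alpha>)) \<circ> tau h \<alpha> (\<alpha> * \<nu> + \<beta>)"
    by (simp add: inv_tau[OF P degree_pos] tau_comp_tau[OF \<nu>' P degree_pos])
  also have "\<dots> = tau h 1 (\<alpha> * \<nu>)"
    using Pset_mult[OF \<nu>' P] \<alpha>
    by (subst tau_comp_tau[OF Pset_inverse[OF P] _ degree_pos]) (simp_all add: field_simps)
  finally show ?thesis by (simp only: comp_assoc)
qed

end

theorem theorem8p5:
  fixes h :: "'a::field poly" and emb :: "'a \<Rightarrow> 'b::alg_closed_field" and k :: nat
  assumes "degree h \<ge> 1"
    and "is_alg_closure_emb emb"
    and "k = card {z. poly (map_poly emb h) z = 0}"
  shows
  "(k = 1 \<longrightarrow> (\<forall>lam. poly (map_poly emb h) lam = 0 \<longrightarrow>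
      (\<forall>l. emb l = lam \<longrightarrow>
          Pset h = {(\<alpha>, (1 - \<alpha>) * l) | \<alpha>. \<alpha> \<noteq> 0}
        \<and> bij_betw (\<lambda>\<alpha>. tau h \<alpha> ((1 - \<alpha>) * l)) {\<alpha>. \<alpha> \<noteq> 0} (tauP h)
        \<and> (\<forall>\<alpha>1 \<alpha>2. \<alpha>1 \<noteq> 0 \<longrightarrow> \<alpha>2 \<noteq> 0 \<longrightarrow>
             tau h (\<alpha>1 * \<alpha>2) ((1 - \<alpha>1 * \<alpha>2) * l)
               = tau h \<alpha>1 ((1 - \<alpha>1) * l) \<circ> tau h \<alpha>2 ((1 - \<alpha>2) * l))
        \<and> is_semidirect (AutG h) (phiset h) (tauP h)
        \<and> inj (phi h) \<and> (\<forall>f g. phi h f \<circ> phi h g = phi h (f + g))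
        \<and> (\<forall>f \<alpha>. \<alpha> \<noteq> 0 \<longrightarrow>
             inv_into UNIV (tau h \<alpha> ((1 - \<alpha>) * l)) \<circ> phi h f \<circ> tau h \<alpha> ((1 - \<alpha>) * l)
               = phi h (smult (\<alpha> ^ (degree h - 1))
                          (pcompose f [:- ((inverse \<alpha> - 1) * l), inverse \<alpha>:]))))
    \<and> (lam \<notin> range emb \<longrightarrow>
          {\<sigma>. is_alg_aut h \<sigma>} = phiset h
        \<and> inj (phi h) \<and> (\<forall>f g. phi h f \<circ> phi h g = phi h (f + g)))))
 \<and> (k \<ge> 2 \<longrightarrow>
      finite (carrier (FactGroup ((AutG h)\<lparr>carrier := tauP h\<rparr>) (tau1G h)))
    \<and> cyclic_group (FactGroup ((AutG h)\<lparr>carrier := tauP h\<rparr>) (tau1G h))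
    \<and> (tauP h \<noteq> tau1G h \<longrightarrow>
         (\<exists>\<alpha> \<beta>. (\<alpha>, \<beta>) \<in> Pset h \<and> \<alpha> \<noteq> 1 \<and> (\<alpha> ^ (k - 1) = 1 \<or> \<alpha> ^ k = 1)
           \<and> is_semidirect ((AutG h)\<lparr>carrier := tauP h\<rparr>) (tau1G h)
                (generate (AutG h) {tau h \<alpha> \<beta>})
           \<and> (\<forall>\<nu>\<in>Gset h. inv_into UNIV (tau h \<alpha> \<beta>) \<circ> tau h 1 \<nu> \<circ> tau h \<alpha> \<beta> = tau h 1 (\<alpha> * \<nu>))
           \<and> is_semidirect ((AutG h)\<lparr>carrier := set_mult (AutG h) (phiset h) (tau1G h)\<rparr>)
                (phiset h) (tau1G h)
           \<and> is_semidirect (AutG h) (set_mult (AutG h) (phiset h) (tau1G h))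
                (generate (AutG h) {tau h \<alpha> \<beta>}))))"
proof -
  interpret alg_closure_emb emb by unfold_locales fact
  interpret ore_algebra h using assms(1) by unfold_locales simp
  let ?R = "{z. poly (map_poly emb h) z = 0}"
  have h0: "h \<noteq> 0" using degree_pos by auto
  have roots: "?R = {lam}" if "k = 1" "poly (map_poly emb h) lam = 0" for lam
  proof -
    obtain z where "?R = {z}" using \<open>k = 1\<close> assms(3) by (metis card_1_singletonE)
    moreover have "lam \<in> ?R" using that(2) by simp
    ultimately show ?thesis by simp
  qed
  show ?thesis
    (is "(k = 1 \<longrightarrow> (\<forall>lam. ?root lam \<longrightarrow> (\<forall>l. emb l = lam \<longrightarrow> ?in l) \<and> (lam \<notin> range emb \<longrightarrow> ?out))) \<and>
      (k \<ge> 2 \<longrightarrow> ?many)")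
  proof -
    have in_field: "?in l" if "k = 1" "?root lam" "emb l = lam" for lam l
    proof (intro conjI allI impI)
      have R: "?R = {emb l}" using roots that by simp
      show P: "Pset h = {(\<alpha>, (1 - \<alpha>) * l) | \<alpha>. \<alpha> \<noteq> 0}"
        by (rule Pset_unique_root[OF h0 R])
      then have mem: "(\<alpha>, (1 - \<alpha>) * l) \<in> Pset h" if "\<alpha> \<noteq> 0" for \<alpha>
        using that by blast
      show "bij_betw (\<lambda>\<alpha>. tau h \<alpha> ((1 - \<alpha>) * l)) {\<alpha>. \<alpha> \<noteq> 0} (tauP h)"
        by (auto simp: bij_betw_def inj_on_def tau_eq_iff tauP_def P)
      show "tau h (\<alpha>1 * \<alpha>2) ((1 - \<alpha>1 * \<alpha>2) * l)
          = tau h \<alpha>1 ((1 - \<alpha>1) * l) \<circ> tau h \<alpha>2 ((1 - \<alpha>2) * l)"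
        if "\<alpha>1 \<noteq> 0" "\<alpha>2 \<noteq> 0" for \<alpha>1 \<alpha>2
        by (subst tau_comp_tau[OF mem mem degree_pos]) (use that in \<open>simp_all add: algebra_simps\<close>)
      show "inv_into UNIV (tau h \<alpha> ((1 - \<alpha>) * l)) \<circ> phi h f \<circ> tau h \<alpha> ((1 - \<alpha>) * l)
          = phi h (smult (\<alpha> ^ (degree h - 1))
              (pcompose f [:- ((inverse \<alpha> - 1) * l), inverse \<alpha>:]))" if "\<alpha> \<noteq> 0" for f \<alpha>
      proof -
        \<comment> \<open>Rewrites the shift of the inverse affine map for
          \<open>\<beta> = (1 - \<alpha>) l\<close> in the form required here.\<close>
        have "(1 - \<alpha>) * l * inverse \<alpha> = (inverse \<alpha> - 1) * l"
          using that by (simp add: field_simps)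
        then show ?thesis by (simp only: conj_phi[OF mem[OF that]])
      qed
    qed (simp_all only: semidirect_phi_tauP inj_phi phi_comp_phi)
    have not_in_field: "?out" if "k = 1" "?root lam" "lam \<notin> range emb" for lam
    proof (intro conjI allI)
      have "Pset h = {(1, 0)}"
        by (rule Pset_unique_root_not_in_field[OF roots[OF that(1,2)] that(3)])
      \<comment> \<open>With a trivial complement, the semidirect decomposition reduces to its
        normal factor.\<close>
      then have "tauP h = {id}" by (simp add: tauP_def tau_1_0)
      then have "phiset h <#>\<^bsub>AutG h\<^esub> {id} = carrier (AutG h)"
        using semidirect_phi_tauP by (simp add: is_semidirect_def)
      then show "{\<sigma>. is_alg_aut h \<sigma>} = phiset h" by (simp add: set_mult_def)
    qed (simp_all only: inj_phi phi_comp_phi)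
    have many: "?many" if "k \<ge> 2"
    proof -
      have fin: "finite (Pset h)" using finite_Pset[OF h0] that assms(3) by simp
      show ?thesis
      proof (intro conjI impI cyclic_quotient[OF fin])
        assume "tauP h \<noteq> tau1G h"
        \<comment> \<open>The scale \<alpha> generates the group of all scales; \<beta> is any shift
          that occurs with it.\<close>
        then obtain \<alpha> \<beta> where *: "(\<alpha>, \<beta>) \<in> Pset h" "\<alpha> \<noteq> 1"
          "x_scale ` tauP h = range (\<lambda>i::nat. \<alpha> ^ i)"
          using cyclic_quotient(3)[OF fin] by blast
        show "\<exists>\<alpha> \<beta>. (\<alpha>, \<beta>) \<in> Pset h \<and> \<alpha> \<noteq> 1 \<and> (\<alpha> ^ (k - 1) = 1 \<or> \<alpha> ^ k = 1)
           \<and> is_semidirect TauP (tau1G h) (generate (AutG h) {tau h \<alpha> \<beta>})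
           \<and> (\<forall>\<nu>\<in>Gset h. inv_into UNIV (tau h \<alpha> \<beta>) \<circ> tau h 1 \<nu> \<circ> tau h \<alpha> \<beta> = tau h 1 (\<alpha> * \<nu>))
           \<and> is_semidirect ((AutG h)\<lparr>carrier := PhiTau1\<rparr>) (phiset h) (tau1G h)
           \<and> is_semidirect (AutG h) PhiTau1 (generate (AutG h) {tau h \<alpha> \<beta>})"
          by (intro exI[of _ \<alpha>] exI[of _ \<beta>] conjI ballI * semidirect_generate_tau[OF *]
              semidirect_PhiTau1 conj_tau1[OF *(1)] Pset_power_card_roots[OF h0 *(1,2) assms(3)])
      qed
    qed
    show ?thesis
    proof (rule conjI)
      show "k = 1 \<longrightarrow> (\<forall>lam. ?root lam \<longrightarrow> (\<forall>l. emb l = lam \<longrightarrow> ?in l) \<and> (lam \<notin> range emb \<longrightarrow> ?out))"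
      proof (intro impI allI, rule conjI; intro impI allI)
        show "?in l" if "k = 1" "?root lam" "emb l = lam" for lam l
          using that by (rule in_field)
        show "?out" if "k = 1" "?root lam" "lam \<notin> range emb" for lam
          using that by (rule not_in_field)
      qed
      show "k \<ge> 2 \<longrightarrow> ?many" using many by (rule impI)
    qed
  qed
qed

end
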